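(* Let $F=(f_1,\dots,f_m)$ be the (sorted) input list of homogeneous polynomials of the algorithm F5C. If, in the pass of the main loop of F5C with loop counter $i$, the call of the subroutine $\mathrm{Incremental\_Basis}$ terminates, then it terminates with a Gröbner basis of $\langle f_1,\dots,f_i\rangle$ with respect to $<_T$; that is, if its output is $G_{\mathrm{curr}}$, then $\{\mathrm{Poly}(\lambda):\lambda\in G_{\mathrm{curr}}\}$ is a Gröbner basis of $\langle f_1,\dots,f_i\rangle$.
   Context: **Preliminaries.** $\mathcal R=\mathbb F[x_1,\dots,x_n]$ over a field $\mathbb F$; $\mathbb M$ is the set of monomials (power products without coefficient); $<_T$ is a fixed admissible monomial ordering; $\mathrm{HM}(p)$, $\mathrm{HC}(p)$ are the head monomial and head coefficient of $p\ne0$. The $S$-polynomial of nonzero $p,q$ is $\mathrm{HC}(q)\sigma_{p,q}\,p-\mathrm{HC}(p)\sigma_{q,p}\,q$ with $\sigma_{p,q}=\mathrm{lcm}(\mathrm{HM}(p),\mathrm{HM}(q))/\mathrm{HM}(p)$. A finite list $G$ in an ideal $I$ is a Gröbner basis of $I$ if $\langle G\rangle=I$ and each nonzero $p\in I$ has $\mathrm{HM}(g)\mid\mathrm{HM}(p)$ for some $g\in G$. **Signatures.** Signatures are formal symbols $\tau\mathbf F_\nu$ with $\tau\in\mathbb M$, $\nu\in\mathbb N$ ($\mathbf F_\nu=1\mathbf F_\nu$), ordered by $\tau'\mathbf F_a\prec\tau\mathbf F_b$ iff $a<b$, or $a=b$ and $\tau'<_T\tau$. For $u\in\mathbb M$,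 $u\cdot\tau\mathbf F_\nu=(u\tau)\mathbf F_\nu$. **Algorithm F5C.** Global data: a list $r$ of labeled polynomials $r_k=(\mathrm{Sig}(k),\mathrm{Poly}(k))$ and lists $\mathrm{Rule}_1,\mathrm{Rule}_2,\dots$ of pairs $(\tau,j)$. "A monomial is top-reducible by $G_{\mathrm{prev}}$" means it is divisible by $\mathrm{HM}(\mathrm{Poly}(g))$ for some $g\in G_{\mathrm{prev}}$. $\#L$ is the length of $L$. *Main routine.* Input: homogeneous nonzero $f_1,\dots,f_m$, sorted by increasing total degree, ties broken by increasing head monomial. $\mathrm{Rule}$ starts as one empty list $\mathrm{Rule}_1$; $r:=((\mathbf F_1,f_1/\mathrm{HC}(f_1)))$; $G_{\mathrm{prev}}:=\{1\}$; $B:=\{f_1\}$. For $i=2,\dots,m$: append $(\mathbf F_{\#r+1},f_i/\mathrm{HC}(f_i))$ to $r$; $G_{\mathrm{curr}}:=\mathrm{Incremental\_Basis}(\#r,B,G_{\mathrm{prev}})$; if $\mathrm{Poly}(\lambda)=1$ for some $\lambda\in G_{\mathrm{curr}}$ return $\{1\}$; $G_{\mathrm{prev}}:=\mathrm{Setup\_Reduced\_Basis}(G_{\mathrm{curr}})$; $B:=\{\mathrm{Poly}(\lambda):\lambda\in G_{\mathrm{prev}}\}$. Return $B$. *Setup_Reduced_Basis$(G)$.* Let $B=(B_1,\dots,B_{\#B})$ be the interreduction of $\{\mathrm{Poly}(k):k\in G\}$, normalized to head coefficients $1$ (so it is the reduced Gröbner basis when the input is a Gröbner basis). Replace $r$ by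 $((\mathbf F_j,B_j))_{j=1}^{\#B}$ and $\mathrm{Rule}$ by $\#B$ empty lists; then for $1\le j<k\le\#B$ call $\mathrm{Add\_Rule}(u\mathbf F_k,0)$ with $u=\mathrm{lcm}(\mathrm{HM}(B_j),\mathrm{HM}(B_k))/\mathrm{HM}(B_k)$. Return $\{1,\dots,\#B\}$. (The index $0$ refers to a fictional "phantom" polynomial.) *Incremental_Basis$(i,B,G_{\mathrm{prev}})$* (here $i$ is the formal parameter). $c:=\#r$; $G_{\mathrm{curr}}:=G_{\mathrm{prev}}\cup\{c\}$; append an empty list to $\mathrm{Rule}$; $P:=\bigcup_{j\in G_{\mathrm{prev}}}\mathrm{Critical\_Pair}(c,j,i,G_{\mathrm{prev}})$. While $P\neq\emptyset$: let $d$ be the minimum of $\deg t$ over $(t,k,u,\ell,v)\in P$, $P_d$ the set of pairs with $\deg t=d$, $P:=P\setminus P_d$; $S:=\mathrm{Compute\_SPols}(P_d)$; $R:=\mathrm{Reduction}(S,B,G_{\mathrm{prev}},G_{\mathrm{curr}})$; for each $k\in R$: $P:=P\cup\bigcup_{j\in G_{\mathrm{curr}}}\mathrm{Critical\_Pair}(k,j,i,G_{\mathrm{prev}})$, then $G_{\mathrm{curr}}:=G_{\mathrm{curr}}\cup\{k\}$. Return $G_{\mathrm{curr}}$. *Critical_Pair$(k,\ell,i,G_{\mathrm{prev}})$.* $t:=\mathrm{lcm}(\mathrm{HM}(\mathrm{Poly}(k)),\mathrm{HM}(\mathrm{Poly}(\ell)))$, $u_1:=t/\mathrm{HM}(\mathrm{Poly}(k))$,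 $u_2:=t/\mathrm{HM}(\mathrm{Poly}(\ell))$, $\mathrm{Sig}(k)=\tau_1\mathbf F_{\nu_1}$, $\mathrm{Sig}(\ell)=\tau_2\mathbf F_{\nu_2}$. If for $e=1$ or $e=2$ we have $\nu_e=i$ and $u_e\tau_e$ top-reducible by $G_{\mathrm{prev}}$, return $\emptyset$. If $u_1\mathrm{Sig}(k)\prec u_2\mathrm{Sig}(\ell)$ swap $u_1,u_2$ and $k,\ell$. Return $\{(t,k,u_1,\ell,u_2)\}$. *Compute_SPols$(P)$.* $S:=()$. For $(t,k,u,\ell,v)\in P$ by increasing $t$: if neither $\mathrm{Is\_Rewritable}(u,k)$ nor $\mathrm{Is\_Rewritable}(v,\ell)$, let $s$ be the $S$-polynomial of $\mathrm{Poly}(k),\mathrm{Poly}(\ell)$; append $(u\,\mathrm{Sig}(k),s)$ to $r$; call $\mathrm{Add\_Rule}(u\,\mathrm{Sig}(k),\#r)$; if $s\ne0$ append $\#r$ to $S$. Return $S$ sorted by increasing signature. *Add_Rule$(\tau\mathbf F_\nu,k)$* appends $(\tau,k)$ to $\mathrm{Rule}_\nu$. *Find_Rewriting$(u,k)$*, with $\mathrm{Sig}(k)=\tau_k\mathbf F_\nu$, returns $j$ for the last entry $(\tau_j,j)$ of $\mathrm{Rule}_\nu$ with $\tau_j\mid u\tau_k$, and returns $k$ if there is none. *Is_Rewritable$(u,k)$* is true iff $\mathrm{Find\_Rewriting}(u,k)\neq k$. *Reduction$(S,B,G_{\mathrm{prev}},G_{\mathrm{curr}})$.* $\mathit{todo}:=S$,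 $\mathit{completed}:=\emptyset$. While $\mathit{todo}$ is nonempty: remove from it $k$ with $\mathrm{Sig}(k)$ minimal; replace $\mathrm{Poly}(k)$ by its normal form (complete reduction) modulo $B$; $(N,D):=\mathrm{Top\_Reduction}(k,G_{\mathrm{prev}},G_{\mathrm{curr}}\cup\mathit{completed})$; add $N$ to $\mathit{completed}$ and $D$ to $\mathit{todo}$. Return $\mathit{completed}$. *Top_Reduction$(k,G_{\mathrm{prev}},G_{\mathrm{curr}})$.* If $\mathrm{Poly}(k)=0$ return $(\emptyset,\emptyset)$. Let $p:=\mathrm{Poly}(k)$, $J:=\mathrm{Find\_Reductor}(k,G_{\mathrm{prev}},G_{\mathrm{curr}})$. If $J=\emptyset$, make $\mathrm{Poly}(k)$ monic and return $(\{k\},\emptyset)$. Otherwise $J=\{j\}$; $q:=\mathrm{Poly}(j)$, $u:=\mathrm{HM}(p)/\mathrm{HM}(q)$, $p':=p-\frac{\mathrm{HC}(p)}{\mathrm{HC}(q)}uq$, made monic if nonzero. If $u\,\mathrm{Sig}(j)\prec\mathrm{Sig}(k)$ set $\mathrm{Poly}(k):=p'$ and return $(\emptyset,\{k\})$. Otherwise append $(u\,\mathrm{Sig}(j),p')$ to $r$, call $\mathrm{Add\_Rule}(u\,\mathrm{Sig}(j),\#r)$ and return $(\emptyset,\{k,\#r\})$. *Find_Reductor$(k,G_{\mathrm{prev}},G_{\mathrm{curr}})$* returns $\{j\}$ for the first $j\in G_{\mathrm{curr}}$ such that $\mathrm{HM}(\mathrm{Poly}(j))\mid\mathrm{HM}(\mathrm{Poly}(k))$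 and, with $u$ the quotient and $\mathrm{Sig}(j)=\tau_j\mathbf F_{\nu_j}$: $u\,\mathrm{Sig}(j)\neq\mathrm{Sig}(k)$, $\mathrm{Is\_Rewritable}(u,j)$ is false, and $u\tau_j$ is not top-reducible by $G_{\mathrm{prev}}$; it returns $\emptyset$ if there is no such $j$. *)

theory Defs
  imports Complex_Main "HOL-Library.Poly_Mapping" "HOL-Library.Multiset"
begin

text \<open>
  Monomials in the variables \<open>'x\<close> are exponent functions, written additively: the product of two
  monomials is \<open>s + t\<close>, the monomial 1 is \<open>0\<close>, and, if \<open>s\<close> divides \<open>t\<close>, the quotient is \<open>t - s\<close>.
  The type \<open>('x, 'a) mpoly\<close>, with \<open>'x\<close> finite and \<open>'a\<close> a field, is the polynomial ring
  over \<open>'a\<close> in \<open>CARD('x)\<close> variables; the product \<open>c * u * p\<close> of a coefficient, a monomial and a polynomial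
  is \<open>Poly_Mapping.single u c * p\<close>.
\<close>

type_synonym 'x mon = "'x \<Rightarrow>\<^sub>0 nat"
type_synonym ('x, 'a) mpoly = "'x mon \<Rightarrow>\<^sub>0 'a"

definition mdvd :: "'x mon \<Rightarrow> 'x mon \<Rightarrow> bool" where
  "mdvd s t \<longleftrightarrow> (\<exists>u. t = s + u)"

lift_definition mlcm :: "'x mon \<Rightarrow> 'x mon \<Rightarrow> 'x mon"
  is "\<lambda>s t x. max (s x) (t x)"
proof -
  fix s t :: "'x \<Rightarrow> nat"
  assume "finite {x. s x \<noteq> 0}" "finite {x. t x \<noteq> 0}"
  then show "finite {x. max (s x) (t x) \<noteq> 0}"
    by (rule finite_subset[OF _ finite_UnI, rotated]) (auto simp: max_def split: if_splits)
qed

definition mdeg :: "'x::finite mon \<Rightarrow> nat" where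
  "mdeg t = (\<Sum>x\<in>UNIV. Poly_Mapping.lookup t x)"

definition pdeg :: "('x::finite, 'a::zero) mpoly \<Rightarrow> nat" where
  "pdeg p = Max (mdeg ` Poly_Mapping.keys p)"

definition homogeneous :: "('x::finite, 'a::zero) mpoly \<Rightarrow> bool" where
  "homogeneous p \<longleftrightarrow> (\<exists>d. \<forall>t\<in>Poly_Mapping.keys p. mdeg t = d)"

definition ideal_gen :: "('x, 'a::field) mpoly set \<Rightarrow> ('x, 'a) mpoly set" where
  "ideal_gen S = module.span (*) S"


text \<open>The signature \<open>\<tau> F\<^sub>\<nu>\<close> is the pair \<open>(\<tau>, \<nu>)\<close>.\<close>

type_synonym 'x sig = "'x mon \<times> nat"

definition sig_mult :: "'x mon \<Rightarrow> 'x sig \<Rightarrow> 'x sig" where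
  "sig_mult u \<sigma> = (u + fst \<sigma>, snd \<sigma>)"


text \<open>
  The global data of the algorithm. Labeled polynomials and rule lists are numbered from 1,
  so entry \<open>k\<close> is found at list position \<open>k - 1\<close>.
\<close>

record (overloaded) ('x, 'a::zero) state =
  labeled :: "('x sig \<times> ('x, 'a) mpoly) list"
  rules :: "('x mon \<times> nat) list list"

definition num :: "('x, 'a::zero) state \<Rightarrow> nat" where
  "num s = length (labeled s)"

definition Sig :: "('x, 'a::zero) state \<Rightarrow> nat \<Rightarrow> 'x sig" where
  "Sig s k = fst (labeled s ! (k - 1))"

definition Poly :: "('x, 'a::zero) state \<Rightarrow> nat \<Rightarrow> ('x, 'a) mpoly" where
  "Poly s k = snd (labeled s ! (k - 1))"

definition set_Poly :: "nat \<Rightarrow> ('x, 'a) mpoly \<Rightarrow> ('x, 'a::zero) state \<Rightarrow> ('x, 'a) state" where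
  "set_Poly k p s = s\<lparr>labeled := (labeled s)[k - 1 := (Sig s k, p)]\<rparr>"

definition append_labeled ::
    "'x sig \<Rightarrow> ('x, 'a) mpoly \<Rightarrow> ('x, 'a::zero) state \<Rightarrow> ('x, 'a) state" where
  "append_labeled \<sigma> p s = s\<lparr>labeled := labeled s @ [(\<sigma>, p)]\<rparr>"

definition add_rule :: "'x sig \<Rightarrow> nat \<Rightarrow> ('x, 'a::zero) state \<Rightarrow> ('x, 'a) state" where
  "add_rule \<sigma> k s =
     (let n = snd \<sigma> - 1 in s\<lparr>rules := (rules s)[n := (rules s ! n) @ [(fst \<sigma>, k)]]\<rparr>)"

definition find_rewriting :: "('x, 'a::zero) state \<Rightarrow> 'x mon \<Rightarrow> nat \<Rightarrow> nat" where
  "find_rewriting s u k =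
     (case find (\<lambda>(\<tau>, j). mdvd \<tau> (u + fst (Sig s k))) (rev (rules s ! (snd (Sig s k) - 1))) of
        None \<Rightarrow> k
      | Some (\<tau>, j) \<Rightarrow> j)"

definition is_rewritable :: "('x, 'a::zero) state \<Rightarrow> 'x mon \<Rightarrow> nat \<Rightarrow> bool" where
  "is_rewritable s u k \<longleftrightarrow> find_rewriting s u k \<noteq> k"


text \<open>A critical pair \<open>(t, k, u, \<ell>, v)\<close>.\<close>

type_synonym 'x cpair = "'x mon \<times> nat \<times> 'x mon \<times> nat \<times> 'x mon"

text \<open>
  The algorithm need not terminate, and it leaves open in which order sets are traversed and ties
  are broken. Each routine that iterates or chooses is therefore a relation between its input and its
  possible results, the last arguments being the resulting global data and return value; it relates
  an input to a result iff some terminating run on this input yields this result.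
\<close>

locale monomial_order =
  fixes less_mon :: "'x::finite mon \<Rightarrow> 'x mon \<Rightarrow> bool"  (infix \<open>\<prec>\<^sub>T\<close> 50)
  assumes linear: "class.linorder (\<lambda>s t. s \<prec>\<^sub>T t \<or> s = t) (\<prec>\<^sub>T)"
    and one_least: "t \<noteq> 0 \<Longrightarrow> 0 \<prec>\<^sub>T t"
    and mult_mono: "s \<prec>\<^sub>T t \<Longrightarrow> s + u \<prec>\<^sub>T t + u"
begin

definition HM :: "('x, 'a::zero) mpoly \<Rightarrow> 'x mon" where
  "HM p = (THE t. t \<in> Poly_Mapping.keys p \<and> (\<forall>s\<in>Poly_Mapping.keys p. s \<prec>\<^sub>T t \<or> s = t))"

definition HC :: "('x, 'a::zero) mpoly \<Rightarrow> 'a" where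
  "HC p = Poly_Mapping.lookup p (HM p)"

definition monic :: "('x, 'a::field) mpoly \<Rightarrow> ('x, 'a) mpoly" where
  "monic p = Poly_Mapping.single 0 (1 / HC p) * p"

definition S_poly :: "('x, 'a::field) mpoly \<Rightarrow> ('x, 'a) mpoly \<Rightarrow> ('x, 'a) mpoly" where
  "S_poly p q =
     (let t = mlcm (HM p) (HM q)
      in Poly_Mapping.single (t - HM p) (HC q) * p - Poly_Mapping.single (t - HM q) (HC p) * q)"

text \<open>\<open>HM 0\<close> is an arbitrary value, so the zero polynomial must not serve as a divisor.\<close>

definition groebner_basis :: "('x, 'a::field) mpoly set \<Rightarrow> ('x, 'a) mpoly set \<Rightarrow> bool" where
  "groebner_basis G I \<longleftrightarrow>
     finite G \<and> ideal_gen G = I \<and> (\<forall>p\<in>I. p \<noteq> 0 \<longrightarrow> (\<exists>g\<in>G. g \<noteq> 0 \<and> mdvd (HM g) (HM p)))"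

definition sorted_input :: "('x, 'a::field) mpoly list \<Rightarrow> bool" where
  "sorted_input = sorted_wrt
     (\<lambda>p q. pdeg p < pdeg q \<or> pdeg p = pdeg q \<and> (HM p \<prec>\<^sub>T HM q \<or> HM p = HM q))"


text \<open>\<open>reduces B p q\<close>: one reduction step, cancelling an arbitrary (not only the head) term of \<open>p\<close>.\<close>

definition reduces ::
    "('x, 'a::field) mpoly set \<Rightarrow> ('x, 'a) mpoly \<Rightarrow> ('x, 'a) mpoly \<Rightarrow> bool" where
  "reduces B p q \<longleftrightarrow>
     (\<exists>g\<in>B. \<exists>t\<in>Poly_Mapping.keys p. g \<noteq> 0 \<and> mdvd (HM g) t \<and>
        q = p - Poly_Mapping.single (t - HM g) (Poly_Mapping.lookup p t / HC g) * g)"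

definition normal_form ::
    "('x, 'a::field) mpoly set \<Rightarrow> ('x, 'a) mpoly \<Rightarrow> ('x, 'a) mpoly \<Rightarrow> bool" where
  "normal_form B p q \<longleftrightarrow> (reduces B)\<^sup>*\<^sup>* p q \<and> \<not> (\<exists>q'. reduces B q q')"

text \<open>Interreduction: reduce elements by the remaining ones, discarding zeros, as long as possible.\<close>

definition interreduction_step ::
    "('x, 'a::field) mpoly set \<Rightarrow> ('x, 'a) mpoly set \<Rightarrow> bool" where
  "interreduction_step B B' \<longleftrightarrow>
     (\<exists>p\<in>B. \<exists>q. reduces (B - {p}) p q \<and> B' = insert q (B - {p}) - {0})"

definition interreduction ::
    "('x, 'a::field) mpoly set \<Rightarrow> ('x, 'a) mpoly set \<Rightarrow> bool" where
  "interreduction A B \<longleftrightarrow>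
     (\<exists>B'. interreduction_step\<^sup>*\<^sup>* (A - {0}) B' \<and> \<not> (\<exists>B''. interreduction_step B' B'') \<and>
        B = monic ` B')"


definition sig_less :: "'x sig \<Rightarrow> 'x sig \<Rightarrow> bool"  (infix \<open>\<prec>\<^sub>S\<close> 50) where
  "\<sigma> \<prec>\<^sub>S \<sigma>' \<longleftrightarrow> snd \<sigma> < snd \<sigma>' \<or> snd \<sigma> = snd \<sigma>' \<and> fst \<sigma> \<prec>\<^sub>T fst \<sigma>'"

definition top_reducible_by :: "('x, 'a::field) state \<Rightarrow> nat set \<Rightarrow> 'x mon \<Rightarrow> bool" where
  "top_reducible_by s Gprev t \<longleftrightarrow> (\<exists>g\<in>Gprev. mdvd (HM (Poly s g)) t)"


definition critical_pair ::
    "('x, 'a::field) state \<Rightarrow> nat \<Rightarrow> nat \<Rightarrow> nat \<Rightarrow> nat set \<Rightarrow> 'x cpair set" where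
  "critical_pair s k l i Gprev =
     (let t = mlcm (HM (Poly s k)) (HM (Poly s l));
          u1 = t - HM (Poly s k);
          u2 = t - HM (Poly s l);
          (\<tau>1, \<nu>1) = Sig s k;
          (\<tau>2, \<nu>2) = Sig s l
      in if \<nu>1 = i \<and> top_reducible_by s Gprev (u1 + \<tau>1) \<or>
            \<nu>2 = i \<and> top_reducible_by s Gprev (u2 + \<tau>2) then {}
         else if sig_mult u1 (Sig s k) \<prec>\<^sub>S sig_mult u2 (Sig s l) then {(t, l, u2, k, u1)}
         else {(t, k, u1, l, u2)})"


fun compute_spols_list ::
    "'x cpair list \<Rightarrow> ('x, 'a::field) state \<Rightarrow> nat list \<Rightarrow> ('x, 'a) state \<times> nat list" where
  "compute_spols_list [] s S = (s, S)"
| "compute_spols_list ((t, k, u, l, v) # ps) s S =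
     (if \<not> is_rewritable s u k \<and> \<not> is_rewritable s v l
      then let p = S_poly (Poly s k) (Poly s l);
               \<sigma> = sig_mult u (Sig s k);
               s1 = append_labeled \<sigma> p s;
               s2 = add_rule \<sigma> (num s1) s1
           in compute_spols_list ps s2 (if p \<noteq> 0 then S @ [num s2] else S)
      else compute_spols_list ps s S)"

definition compute_spols ::
    "('x, 'a::field) state \<Rightarrow> 'x cpair set \<Rightarrow> ('x, 'a) state \<Rightarrow> nat list \<Rightarrow> bool" where
  "compute_spols s P s' S' \<longleftrightarrow>
     (\<exists>ps S. distinct ps \<and> set ps = P \<and>
        sorted_wrt (\<lambda>(t, _) (t', _). t \<prec>\<^sub>T t' \<or> t = t') ps \<and>
        compute_spols_list ps s [] = (s', S) \<and>
        mset S' = mset S \<and>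
        sorted_wrt (\<lambda>k l. Sig s' k \<prec>\<^sub>S Sig s' l \<or> Sig s' k = Sig s' l) S')"


text \<open>\<open>None\<close> stands for the result \<open>\<emptyset>\<close>; the list \<open>js\<close> is the order in which \<open>G\<close> is searched.\<close>

definition find_reductor ::
    "('x, 'a::field) state \<Rightarrow> nat \<Rightarrow> nat set \<Rightarrow> nat set \<Rightarrow> nat option \<Rightarrow> bool" where
  "find_reductor s k Gprev G J \<longleftrightarrow>
     (\<exists>js. distinct js \<and> set js = G \<and>
        J = find (\<lambda>j. mdvd (HM (Poly s j)) (HM (Poly s k)) \<and>
                      (let u = HM (Poly s k) - HM (Poly s j)
                       in sig_mult u (Sig s j) \<noteq> Sig s k \<and>
                          \<not> is_rewritable s u j \<and>
                          \<not> top_reducible_by s Gprev (u + fst (Sig s j)))) js)"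

text \<open>The monic polynomial \<open>p'\<close> obtained by one top-reduction of \<open>p\<close> by \<open>q\<close>.\<close>

definition top_reduct :: "('x, 'a::field) mpoly \<Rightarrow> ('x, 'a) mpoly \<Rightarrow> ('x, 'a) mpoly" where
  "top_reduct p q =
     (let p' = p - Poly_Mapping.single (HM p - HM q) (HC p / HC q) * q
      in if p' = 0 then 0 else monic p')"

inductive top_reduction ::
    "('x, 'a::field) state \<Rightarrow> nat \<Rightarrow> nat set \<Rightarrow> nat set \<Rightarrow>
     ('x, 'a) state \<Rightarrow> nat set \<Rightarrow> nat set \<Rightarrow> bool"
  for s :: "('x, 'a::field) state" and k :: nat and Gprev G :: "nat set" where
  zero: "top_reduction s k Gprev G s {} {}"
    if "Poly s k = 0"
| irreducible: "top_reduction s k Gprev G (set_Poly k (monic (Poly s k)) s) {k} {}"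
    if "Poly s k \<noteq> 0" and "find_reductor s k Gprev G None"
| safe: "top_reduction s k Gprev G (set_Poly k (top_reduct (Poly s k) (Poly s j)) s) {} {k}"
    if "Poly s k \<noteq> 0" and "find_reductor s k Gprev G (Some j)"
      and "u = HM (Poly s k) - HM (Poly s j)"
      and "sig_mult u (Sig s j) \<prec>\<^sub>S Sig s k"
| unsafe: "top_reduction s k Gprev G (add_rule (sig_mult u (Sig s j)) (num s1) s1) {} {k, num s1}"
    if "Poly s k \<noteq> 0" and "find_reductor s k Gprev G (Some j)"
      and "u = HM (Poly s k) - HM (Poly s j)"
      and "\<not> sig_mult u (Sig s j) \<prec>\<^sub>S Sig s k"
      and "s1 = append_labeled (sig_mult u (Sig s j)) (top_reduct (Poly s k) (Poly s j)) s"

text \<open>\<open>reduction_loop B Gprev Gcurr s todo completed s' R\<close>\<close>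

inductive reduction_loop ::
    "('x, 'a::field) mpoly set \<Rightarrow> nat set \<Rightarrow> nat set \<Rightarrow>
     ('x, 'a) state \<Rightarrow> nat set \<Rightarrow> nat set \<Rightarrow> ('x, 'a) state \<Rightarrow> nat set \<Rightarrow> bool"
  for B :: "('x, 'a::field) mpoly set" and Gprev Gcurr :: "nat set" where
  finish: "reduction_loop B Gprev Gcurr s {} completed s completed"
| step: "reduction_loop B Gprev Gcurr s todo completed s' R"
    if "k \<in> todo" and "\<forall>k'\<in>todo. \<not> Sig s k' \<prec>\<^sub>S Sig s k"
      and "normal_form B (Poly s k) q"
      and "top_reduction (set_Poly k q s) k Gprev (Gcurr \<union> completed) s1 N D"
      and "reduction_loop B Gprev Gcurr s1 (todo - {k} \<union> D) (completed \<union> N) s' R"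

definition reduction ::
    "('x, 'a::field) state \<Rightarrow> nat list \<Rightarrow> ('x, 'a) mpoly set \<Rightarrow> nat set \<Rightarrow> nat set \<Rightarrow>
     ('x, 'a) state \<Rightarrow> nat set \<Rightarrow> bool" where
  "reduction s S B Gprev Gcurr s' R \<longleftrightarrow> reduction_loop B Gprev Gcurr s (set S) {} s' R"


fun add_pairs ::
    "('x, 'a::field) state \<Rightarrow> nat \<Rightarrow> nat set \<Rightarrow> nat list \<Rightarrow>
     'x cpair set \<Rightarrow> nat set \<Rightarrow> 'x cpair set \<times> nat set" where
  "add_pairs s i Gprev [] P Gcurr = (P, Gcurr)"
| "add_pairs s i Gprev (k # ks) P Gcurr =
     add_pairs s i Gprev ks (P \<union> (\<Union>j\<in>Gcurr. critical_pair s k j i Gprev)) (Gcurr \<union> {k})"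

text \<open>\<open>incremental_loop i B Gprev s P Gcurr s' G\<close>\<close>

inductive incremental_loop ::
    "nat \<Rightarrow> ('x, 'a::field) mpoly set \<Rightarrow> nat set \<Rightarrow>
     ('x, 'a) state \<Rightarrow> 'x cpair set \<Rightarrow> nat set \<Rightarrow> ('x, 'a) state \<Rightarrow> nat set \<Rightarrow> bool"
  for i :: nat and B :: "('x, 'a::field) mpoly set" and Gprev :: "nat set" where
  finish: "incremental_loop i B Gprev s {} Gcurr s Gcurr"
| step: "incremental_loop i B Gprev s P Gcurr s' G"
    if "P \<noteq> {}"
      and "d = Min ((\<lambda>(t, _). mdeg t) ` P)"
      and "Pd = {(t, k, u, l, v) \<in> P. mdeg t = d}"
      and "compute_spols s Pd s1 S"
      and "reduction s1 S B Gprev Gcurr s2 R"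
      and "distinct ks" and "set ks = R"
      and "add_pairs s2 i Gprev ks (P - Pd) Gcurr = (P', Gcurr')"
      and "incremental_loop i B Gprev s2 P' Gcurr' s' G"

definition incremental_basis ::
    "('x, 'a::field) state \<Rightarrow> nat \<Rightarrow> ('x, 'a) mpoly set \<Rightarrow> nat set \<Rightarrow>
     ('x, 'a) state \<Rightarrow> nat set \<Rightarrow> bool" where
  "incremental_basis s i B Gprev s' G \<longleftrightarrow>
     (let c = num s;
          s1 = s\<lparr>rules := rules s @ [[]]\<rparr>
      in incremental_loop i B Gprev
           s1 (\<Union>j\<in>Gprev. critical_pair s1 c j i Gprev) (Gprev \<union> {c}) s' G)"


text \<open>The state set up from the interreduced basis \<open>Bs\<close>; 0 is the index of the phantom polynomial.\<close>

definition setup_state :: "('x, 'a::field) mpoly list \<Rightarrow> ('x, 'a) state" where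
  "setup_state Bs =
     fold (\<lambda>(j, k).
             let t = mlcm (HM (Bs ! (j - 1))) (HM (Bs ! (k - 1)))
             in add_rule (sig_mult (t - HM (Bs ! (k - 1))) (0, k)) 0)
       [(j, k). k \<leftarrow> [1..<length Bs + 1], j \<leftarrow> [1..<k]]
       \<lparr>labeled = map (\<lambda>j. ((0, j), Bs ! (j - 1))) [1..<length Bs + 1],
        rules = replicate (length Bs) []\<rparr>"

definition setup_reduced_basis ::
    "('x, 'a::field) state \<Rightarrow> nat set \<Rightarrow> ('x, 'a) state \<Rightarrow> nat set \<Rightarrow> bool" where
  "setup_reduced_basis s G s' G' \<longleftrightarrow>
     (\<exists>Bs. distinct Bs \<and> interreduction (Poly s ` G) (set Bs) \<and>
        s' = setup_state Bs \<and> G' = {1..length Bs})"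


definition append_input ::
    "('x, 'a::field) mpoly \<Rightarrow> ('x, 'a) state \<Rightarrow> ('x, 'a) state" where
  "append_input f s = append_labeled (0, num s + 1) (monic f) s"

text \<open>\<open>f5c_loop F i s Gprev B\<close>: some run on the input \<open>F\<close> reaches the head of the main loop with
  loop counter \<open>i\<close>, global data \<open>s\<close> and these values of the variables.\<close>

inductive f5c_loop ::
    "('x, 'a::field) mpoly list \<Rightarrow> nat \<Rightarrow> ('x, 'a) state \<Rightarrow> nat set \<Rightarrow> ('x, 'a) mpoly set \<Rightarrow> bool"
  for F :: "('x, 'a::field) mpoly list" where
  start: "f5c_loop F 2 \<lparr>labeled = [((0, 1), monic (F ! 0))], rules = [[]]\<rparr> {1} {F ! 0}"
| pass: "f5c_loop F (i + 1) s3 Gprev' (Poly s3 ` Gprev')"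
    if "f5c_loop F i s Gprev B" and "i \<le> length F"
      and "s1 = append_input (F ! (i - 1)) s"
      and "incremental_basis s1 (num s1) B Gprev s2 Gcurr"
      and "\<not> (\<exists>l\<in>Gcurr. Poly s2 l = 1)"
      and "setup_reduced_basis s2 Gcurr s3 Gprev'"

text \<open>In the pass with loop counter \<open>i\<close> of some run on \<open>F\<close>, the call of \<open>incremental_basis\<close>
  terminates with global data \<open>s'\<close> and output \<open>Gcurr\<close>.\<close>

definition f5c_pass_result ::
    "('x, 'a::field) mpoly list \<Rightarrow> nat \<Rightarrow> ('x, 'a) state \<Rightarrow> nat set \<Rightarrow> bool" where
  "f5c_pass_result F i s' Gcurr \<longleftrightarrow>
     i \<le> length F \<and>
     (\<exists>s Gprev B s1. f5c_loop F i s Gprev B \<and> s1 = append_input (F ! (i - 1)) s \<and>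
        incremental_basis s1 (num s1) B Gprev s' Gcurr)"

end

end

theory Submission
  imports Defs
begin

text \<open>
  Fix a pass with new input \<open>f\<close>, and let \<open>S\<close> generate the ideal of the earlier inputs. Every labeled
  polynomial \<open>p\<close> of the pass with signature \<open>\<tau>\<close> satisfies \<open>p = h f\<close> modulo \<open>S\<close> with \<open>HM h = \<tau>\<close>.
  An accepted critical pair makes its larger component rewritable, by the very rule it adds, and
  rewritability persists. So after termination each critical pair is discarded by the final data:
  the syzygy criterion applies, or one of its components is rewritable.

  Each monomial \<open>\<tau>\<close> has a non-rewritable multiple \<open>u p\<^sub>k\<close> of signature \<open>\<tau>\<close>. If \<open>\<tau>\<close> is not divisible by
  an old head monomial and \<open>p\<^sub>k \<noteq> 0\<close>, then no old element and no non-rewritable multiple of smaller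
  signature has the head monomial of \<open>u p\<^sub>k\<close>, as this would give a critical pair that is not discarded.
  By well-founded induction on \<open>\<tau>\<close>, subtracting a scalar multiple of \<open>u p\<^sub>k\<close>, every \<open>h f\<close> plus an element
  of \<open>\<langle>S\<rangle>\<close> with \<open>HM h = \<tau>\<close> has its head monomial divisible by that of an element of the output.
  Only partial correctness is at stake, so the reductions matter just in that they preserve signatures.
\<close>

section \<open>Monomials\<close>

lemma mdvd_iff_lookup_le:
  "mdvd s t \<longleftrightarrow> (\<forall>x. Poly_Mapping.lookup s x \<le> Poly_Mapping.lookup t x)"
proof
  assume "mdvd s t"
  then show "\<forall>x. Poly_Mapping.lookup s x \<le> Poly_Mapping.lookup t x"
    by (auto simp: mdvd_def lookup_add)
next
  assume le: "\<forall>x. Poly_Mapping.lookup s x \<le> Poly_Mapping.lookup t x"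
  have "t = s + (t - s)"
    by (rule poly_mapping_eqI) (use le in \<open>simp add: lookup_add lookup_minus\<close>)
  then show "mdvd s t"
    unfolding mdvd_def by blast
qed

lemma mdvd_refl [simp]: "mdvd s s"
  by (simp add: mdvd_iff_lookup_le)

lemma mdvd_trans: "mdvd s t \<Longrightarrow> mdvd t u \<Longrightarrow> mdvd s u"
  by (meson mdvd_iff_lookup_le order_trans)

lemma mdvd_add: "mdvd s (s + t)" "mdvd s (t + s)"
  by (auto simp: mdvd_iff_lookup_le lookup_add)

lemma mdvd_add_cancel [simp]:
  "mdvd (s + u) (t + u) \<longleftrightarrow> mdvd s t" "mdvd (u + s) (u + t) \<longleftrightarrow> mdvd s t"
  by (simp_all add: mdvd_iff_lookup_le lookup_add)

lemma mdvd_diff_add [simp]: "mdvd s t \<Longrightarrow> t - s + s = t" "mdvd s t \<Longrightarrow> s + (t - s) = t"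
  by (auto simp: mdvd_def add.commute)

lemma mdvd_mlcm [simp]: "mdvd s (mlcm s t)" "mdvd t (mlcm s t)"
  by (simp_all add: mdvd_iff_lookup_le mlcm.rep_eq)

lemma mlcm_least: "mdvd s u \<Longrightarrow> mdvd t u \<Longrightarrow> mdvd (mlcm s t) u"
  by (simp add: mdvd_iff_lookup_le mlcm.rep_eq)

lemma mlcm_commute: "mlcm s t = mlcm t s"
  by (rule poly_mapping_eqI) (simp add: mlcm.rep_eq max.commute)

section \<open>Dickson's lemma\<close>

lemma nat_seq_mono_subseq:
  fixes s :: "nat \<Rightarrow> nat"
  shows "\<exists>f :: nat \<Rightarrow> nat. strict_mono f \<and> mono (\<lambda>n. s (f n))"
proof -
  obtain f :: "nat \<Rightarrow> nat" where f: "strict_mono f" "monoseq (\<lambda>n. s (f n))"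
    using seq_monosub by blast
  then consider "mono (\<lambda>n. s (f n))" | "antimono (\<lambda>n. s (f n))"
    by (auto simp: monoseq_iff)
  then show ?thesis
  proof cases
    case 1
    then show ?thesis using f(1) by blast
  next
    case 2
    \<comment> \<open>\<open>N\<close> is a place where the antimonotone subsequence attains its
      minimum; from there on it is constant, so its tail is nondecreasing.\<close>
    define N where "N = arg_min (\<lambda>n. s (f n)) (\<lambda>_. True)"
    have least: "s (f N) \<le> s (f n)" for n
      unfolding N_def by (rule arg_min_nat_le) simp
    have "s (f (n + N)) = s (f N)" for n
      using antimonoD[OF 2, of N "n + N"] least[of "n + N"] by simp
    then have "mono (\<lambda>n. s (f (n + N)))"
      by (simp add: mono_def)
    moreover have "strict_mono (\<lambda>n. f (n + N))"
      using f(1) by (simp add: strict_mono_def)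
    ultimately show ?thesis
      by (intro exI[of _ "\<lambda>n. f (n + N)"]) simp
  qed
qed

text \<open>Passing to subsequences one variable at a time, finitely often, makes all exponents
  nondecreasing at once; already the first two terms of the final subsequence then serve.\<close>

lemma dickson:
  fixes m :: "nat \<Rightarrow> ('x::finite) mon"
  shows "\<exists>i j. i < j \<and> mdvd (m i) (m j)"
proof -
  have "\<exists>f :: nat \<Rightarrow> nat. strict_mono f \<and> (\<forall>x\<in>X. mono (\<lambda>n. Poly_Mapping.lookup (m (f n)) x))"
    if "finite X" for X
    using that
  proof (induction X)
    case empty
    show ?case by (intro exI[of _ id]) (simp add: strict_mono_def)
  next
    case (insert x X)
    then obtain f :: "nat \<Rightarrow> nat" where f: "strict_mono f"
      "\<forall>y\<in>X. mono (\<lambda>n. Poly_Mapping.lookup (m (f n)) y)"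
      by blast
    obtain g :: "nat \<Rightarrow> nat" where g: "strict_mono g" "mono (\<lambda>n. Poly_Mapping.lookup (m (f (g n))) x)"
      using nat_seq_mono_subseq[of "\<lambda>n. Poly_Mapping.lookup (m (f n)) x"] by blast
    have "mono (\<lambda>n. Poly_Mapping.lookup (m (f (g n))) y)" if "y \<in> X" for y
      using f(2) that strict_mono_mono[OF g(1)] by (simp add: mono_def)
    moreover have "strict_mono (\<lambda>n. f (g n))"
      using f(1) g(1) by (simp add: strict_mono_def)
    ultimately show ?case
      using g(2) by (intro exI[of _ "\<lambda>n. f (g n)"]) simp
  qed
  from this[OF finite_UNIV] obtain f :: "nat \<Rightarrow> nat" where
    f: "strict_mono f" "\<And>x. mono (\<lambda>n. Poly_Mapping.lookup (m (f n)) x)"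
    by blast
  have "mdvd (m (f 0)) (m (f 1))"
    using f(2) by (simp add: mdvd_iff_lookup_le mono_def)
  moreover have "f 0 < f 1"
    using f(1) by (simp add: strict_mono_def)
  ultimately show ?thesis by blast
qed

section \<open>Ideals\<close>

text \<open>The ring is a module over itself whose submodules are the ideals; the general facts on
  \<open>module.span\<close> thereby specialize to \<open>ideal_gen\<close>.\<close>

lemma module_mult: "module ((*) :: 'a::comm_ring_1 \<Rightarrow> 'a \<Rightarrow> 'a)"
  by unfold_locales (simp_all add: algebra_simps)

context
  fixes S :: "('x, 'a::field) mpoly set"
begin

lemmas ideal_gen_base = module.span_base[OF module_mult, of _ S, folded ideal_gen_def]
  and ideal_gen_zero = module.span_zero[OF module_mult, of S, folded ideal_gen_def]
  and ideal_gen_add = module.span_add[OF module_mult, of _ S, folded ideal_gen_def]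
  and ideal_gen_diff = module.span_diff[OF module_mult, of _ S, folded ideal_gen_def]
  and ideal_gen_mult = module.span_scale[OF module_mult, of _ S, folded ideal_gen_def]
  and ideal_gen_minimal = module.span_minimal[OF module_mult, of S, folded ideal_gen_def]
  and ideal_gen_subspace = module.subspace_span[OF module_mult, of S, folded ideal_gen_def]
  and ideal_gen_insert = module.span_insert[OF module_mult, of _ S, folded ideal_gen_def]

end

lemma ideal_gen_empty: "ideal_gen {} = {0}"
  unfolding ideal_gen_def by (rule module.span_empty[OF module_mult])

lemma ideal_gen_singletonE:
  assumes "q \<in> ideal_gen {p}"
  obtains h where "q = h * p"
  using assms ideal_gen_insert[of p "{}"] by (auto simp: ideal_gen_empty)

lemma ideal_gen_subsetI: "S \<subseteq> ideal_gen T \<Longrightarrow> ideal_gen S \<subseteq> ideal_gen T"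
  using ideal_gen_minimal ideal_gen_subspace by blast

lemma ideal_gen_eqI:
  "S \<subseteq> ideal_gen T \<Longrightarrow> T \<subseteq> ideal_gen S \<Longrightarrow> ideal_gen S = ideal_gen T"
  by (simp add: ideal_gen_subsetI subset_antisym)

section \<open>Head monomials\<close>

lemma lookup_single_mult:
  fixes p :: "('x, 'a::field) mpoly" and t :: "'x mon"
  shows
  "Poly_Mapping.lookup (Poly_Mapping.single u c * p) (u + t) =
     c * Poly_Mapping.lookup p t"
  by (simp add: lookup_mult lookup_single when_mult)

lemma keys_single_mult:
  fixes p :: "('x, 'a::field) mpoly"
  assumes "c \<noteq> 0"
  shows "Poly_Mapping.keys (Poly_Mapping.single u c * p) = (+) u ` Poly_Mapping.keys p"
proof
  show "Poly_Mapping.keys (Poly_Mapping.single u c * p) \<subseteq> (+) u ` Poly_Mapping.keys p"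
    using keys_mult[of "Poly_Mapping.single u c" p] assms by auto
  show "(+) u ` Poly_Mapping.keys p \<subseteq> Poly_Mapping.keys (Poly_Mapping.single u c * p)"
    using assms by (auto simp: in_keys_iff lookup_single_mult)
qed

context monomial_order
begin

lemma less_irrefl [simp]: "\<not> s \<prec>\<^sub>T s"
  and less_trans: "s \<prec>\<^sub>T t \<Longrightarrow> t \<prec>\<^sub>T u \<Longrightarrow> s \<prec>\<^sub>T u"
  and less_cases: "s \<prec>\<^sub>T t \<or> s = t \<or> t \<prec>\<^sub>T s"
proof -
  interpret linorder "\<lambda>s t. s \<prec>\<^sub>T t \<or> s = t" "(\<prec>\<^sub>T)" by (rule linear)
  show "\<not> s \<prec>\<^sub>T s" by (rule less_irrefl)
  show "s \<prec>\<^sub>T t \<Longrightarrow> t \<prec>\<^sub>T u \<Longrightarrow> s \<prec>\<^sub>T u" by (rule less_trans)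
  show "s \<prec>\<^sub>T t \<or> s = t \<or> t \<prec>\<^sub>T s" by (rule less_linear)
qed

lemma add_less_cancel [simp]:
  "s + u \<prec>\<^sub>T t + u \<longleftrightarrow> s \<prec>\<^sub>T t" "u + s \<prec>\<^sub>T u + t \<longleftrightarrow> s \<prec>\<^sub>T t"
proof -
  show "s + u \<prec>\<^sub>T t + u \<longleftrightarrow> s \<prec>\<^sub>T t"
    by (metis less_cases less_irrefl less_trans mult_mono)
  then show "u + s \<prec>\<^sub>T u + t \<longleftrightarrow> s \<prec>\<^sub>T t"
    by (simp add: add.commute)
qed

section \<open>Well-foundedness of the monomial order\<close>

lemma mdvd_imp_le: "mdvd s t \<Longrightarrow> s \<prec>\<^sub>T t \<or> s = t"
proof -
  assume "mdvd s t"
  then obtain u where "t = s + u" by (auto simp: mdvd_def)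
  then show ?thesis
    using one_least[of u] add_less_cancel(2)[of s 0 u] by (cases "u = 0") auto
qed

text \<open>In an infinite descending sequence \<open>dickson\<close> finds an earlier term dividing
  a later one, which is then at least as large; this contradicts the descent.\<close>

lemma wfp_less: "wfp (\<prec>\<^sub>T)"
proof -
  have "\<nexists>m. \<forall>n. (m (Suc n), m n) \<in> {(s, t). s \<prec>\<^sub>T t}"
  proof
    assume "\<exists>m. \<forall>n. (m (Suc n), m n) \<in> {(s, t). s \<prec>\<^sub>T t}"
    then obtain m where step: "\<And>n. m (Suc n) \<prec>\<^sub>T m n" by blast
    have "m j \<prec>\<^sub>T m i" if "i < j" for i j
      using that by (induction rule: less_Suc_induct) (auto intro: step less_trans)
    moreover obtain i j where "i < j" "mdvd (m i) (m j)"
      using dickson by blast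
    ultimately show False
      using mdvd_imp_le less_irrefl less_trans by metis
  qed
  then show ?thesis
    by (simp add: wfp_def wf_iff_no_infinite_down_chain)
qed

lemma finite_has_greatest:
  assumes "finite A" and "A \<noteq> {}"
  shows "\<exists>t\<in>A. \<forall>s\<in>A. s \<prec>\<^sub>T t \<or> s = t"
  using assms
proof (induction rule: finite_ne_induct)
  case (insert s A)
  then obtain t where "t \<in> A" "\<forall>s\<in>A. s \<prec>\<^sub>T t \<or> s = t" by blast
  then show ?case
    using less_cases[of s t] by (auto intro: less_trans)
qed simp

lemma HM_eqI:
  assumes "t \<in> Poly_Mapping.keys p" and "\<And>s. s \<in> Poly_Mapping.keys p \<Longrightarrow> s \<prec>\<^sub>T t \<or> s = t"
  shows "HM p = t"
  unfolding HM_def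
proof (rule the_equality)
  fix s
  assume "s \<in> Poly_Mapping.keys p \<and> (\<forall>r\<in>Poly_Mapping.keys p. r \<prec>\<^sub>T s \<or> r = s)"
  then show "s = t"
    using assms less_trans[of s t s] by auto
qed (use assms in blast)

lemma HM_in_keys: "p \<noteq> 0 \<Longrightarrow> HM p \<in> Poly_Mapping.keys p"
  and HM_greatest: "s \<in> Poly_Mapping.keys p \<Longrightarrow> s \<prec>\<^sub>T HM p \<or> s = HM p"
proof -
  have *: "\<exists>t\<in>Poly_Mapping.keys p. HM p = t \<and> (\<forall>s\<in>Poly_Mapping.keys p. s \<prec>\<^sub>T t \<or> s = t)"
    if "p \<noteq> 0"
    using finite_has_greatest[of "Poly_Mapping.keys p"] that HM_eqI[of _ p] by auto
  show "p \<noteq> 0 \<Longrightarrow> HM p \<in> Poly_Mapping.keys p" using * by auto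
  show "s \<in> Poly_Mapping.keys p \<Longrightarrow> s \<prec>\<^sub>T HM p \<or> s = HM p" using * by force
qed

lemma HC_eq_0_iff [simp]: "HC p = 0 \<longleftrightarrow> p = 0"
  using HM_in_keys[of p] by (auto simp: HC_def in_keys_iff)

section \<open>Leading terms under subtraction and multiplication\<close>

text \<open>This also holds of \<open>p = 0\<close>, where \<open>HM\<close> is unspecified, so a
  difference that may vanish needs no separate case.\<close>

definition below :: "'x mon \<Rightarrow> ('x, 'a::field) mpoly \<Rightarrow> bool" where
  "below t p \<longleftrightarrow> (\<forall>s\<in>Poly_Mapping.keys p. s \<prec>\<^sub>T t)"

lemma below_HM_less: "below t p \<Longrightarrow> p \<noteq> 0 \<Longrightarrow> HM p \<prec>\<^sub>T t"
  by (simp add: below_def HM_in_keys)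

lemma HM_less_below: "HM p \<prec>\<^sub>T t \<Longrightarrow> below t p"
  unfolding below_def using HM_greatest less_trans by blast

lemma below_mult:
  assumes "below t p"
  shows "below (t + HM q) (p * q)"
  unfolding below_def
proof
  fix s
  assume "s \<in> Poly_Mapping.keys (p * q)"
  then obtain a b where ab: "s = a + b" "a \<in> Poly_Mapping.keys p" "b \<in> Poly_Mapping.keys q"
    using keys_mult[of p q] by blast
  have "a + b \<prec>\<^sub>T t + b"
    using assms ab(2) by (simp add: below_def)
  moreover have "t + b \<prec>\<^sub>T t + HM q \<or> t + b = t + HM q"
    using HM_greatest[OF ab(3)] by auto
  ultimately show "s \<prec>\<^sub>T t + HM q"
    using ab(1) less_trans[of "a + b" "t + b" "t + HM q"] by auto
qed

lemma diff_below:
  assumes "p \<noteq> 0" and "below (HM p) q"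
  shows "HM (p - q) = HM p" and "HC (p - q) = HC p" and "p - q \<noteq> 0"
proof -
  have "HM p \<notin> Poly_Mapping.keys q"
    using assms(2) by (auto simp: below_def)
  then have coeff: "Poly_Mapping.lookup (p - q) (HM p) = HC p"
    by (simp add: lookup_minus HC_def in_keys_iff)
  then have mem: "HM p \<in> Poly_Mapping.keys (p - q)"
    using assms(1) by (simp add: in_keys_iff)
  show HM: "HM (p - q) = HM p"
  proof (rule HM_eqI[OF mem])
    fix s
    assume "s \<in> Poly_Mapping.keys (p - q)"
    then have "s \<in> Poly_Mapping.keys p \<or> s \<in> Poly_Mapping.keys q"
      using keys_diff[of p q] by blast
    then show "s \<prec>\<^sub>T HM p \<or> s = HM p"
      using HM_greatest[of s p] assms(2) by (auto simp: below_def)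
  qed
  show "HC (p - q) = HC p"
    using coeff HM by (simp add: HC_def)
  show "p - q \<noteq> 0"
    using mem by auto
qed

lemma below_diff_eq_HM:
  assumes "HM p = HM q" and "HC p = HC q"
  shows "below (HM p) (p - q)"
  unfolding below_def
proof
  fix s
  assume s: "s \<in> Poly_Mapping.keys (p - q)"
  then have "s \<noteq> HM p"
    using assms by (auto simp: in_keys_iff lookup_minus HC_def)
  moreover have "s \<in> Poly_Mapping.keys p \<or> s \<in> Poly_Mapping.keys q"
    using s keys_diff[of p q] by blast
  ultimately show "s \<prec>\<^sub>T HM p"
    using HM_greatest[of s p] HM_greatest[of s q] assms(1) by auto
qed

lemma single_mult:
  fixes p :: "('x, 'a::field) mpoly"
  assumes "c \<noteq> 0" and "p \<noteq> 0"
  shows HM_single_mult: "HM (Poly_Mapping.single u c * p) = u + HM p"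
    and HC_single_mult: "HC (Poly_Mapping.single u c * p) = c * HC p"
    and single_mult_nonzero: "Poly_Mapping.single u c * p \<noteq> 0"
proof -
  show HM: "HM (Poly_Mapping.single u c * p) = u + HM p"
  proof (rule HM_eqI)
    show "u + HM p \<in> Poly_Mapping.keys (Poly_Mapping.single u c * p)"
      using assms by (auto simp: keys_single_mult intro!: imageI HM_in_keys)
    fix s
    assume "s \<in> Poly_Mapping.keys (Poly_Mapping.single u c * p)"
    then show "s \<prec>\<^sub>T u + HM p \<or> s = u + HM p"
      using assms(1) by (auto simp: keys_single_mult dest: HM_greatest)
  qed
  show HC: "HC (Poly_Mapping.single u c * p) = c * HC p"
    using HM by (simp add: HC_def lookup_single_mult)
  show "Poly_Mapping.single u c * p \<noteq> 0"
    using assms keys_single_mult[of c u p] by (metis image_is_empty keys_eq_empty)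
qed

lemma HM_one: "HM (1 :: ('x, 'a::field) mpoly) = 0"
  by (rule HM_eqI) auto

lemma HM_mult:
  fixes p q :: "('x, 'a::field) mpoly"
  assumes "p \<noteq> 0" and "q \<noteq> 0"
  shows "HM (p * q) = HM p + HM q"
proof -
  \<comment> \<open>\<open>a\<close> is the leading term of \<open>p\<close>: the head monomial of
    \<open>a * q\<close> is known, and \<open>(a - p) * q\<close> lies below it, so subtracting the
    latter does no harm.\<close>
  define a where "a = Poly_Mapping.single (HM p) (HC p)"
  have a: "a \<noteq> 0" "HM a = HM p" "HC a = HC p"
    using single_mult[of "HC p" "1 :: ('x, 'a) mpoly" "HM p"] assms(1)
    by (simp_all add: a_def HM_one HC_def[of 1])
  have "below (HM p) (a - p)"
    using below_diff_eq_HM[of a p] a by simp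
  then have "below (HM p + HM q) ((a - p) * q)"
    by (rule below_mult)
  moreover have "HM (a * q) = HM p + HM q" "a * q \<noteq> 0"
    using single_mult[of "HC p" q "HM p"] assms by (simp_all add: a_def)
  ultimately have "HM (a * q - (a - p) * q) = HM p + HM q"
    using diff_below(1)[of "a * q" "(a - p) * q"] by simp
  then show ?thesis
    by (simp add: algebra_simps)
qed

lemma HM_monic: "p \<noteq> 0 \<Longrightarrow> HM (monic p) = HM p"
  and monic_eq_0_iff [simp]: "monic p = 0 \<longleftrightarrow> p = 0"
  using single_mult[of "1 / HC p" p 0] by (auto simp: monic_def)

lemma monic_mult_HC: "p \<noteq> 0 \<Longrightarrow> p = Poly_Mapping.single 0 (HC p) * monic p"
  by (simp add: monic_def mult.assoc[symmetric] mult_single)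

lemma monic_in_ideal: "p \<in> ideal_gen S \<Longrightarrow> monic p \<in> ideal_gen S"
  by (simp add: monic_def ideal_gen_mult)

lemma monic_in_ideal_iff [simp]: "monic p \<in> ideal_gen S \<longleftrightarrow> p \<in> ideal_gen S"
  by (metis ideal_gen_mult monic_in_ideal monic_mult_HC monic_eq_0_iff)

section \<open>Groebner bases and interreduction\<close>

lemma ideal_gen_monic: "ideal_gen (monic ` A) = ideal_gen A"
proof (rule ideal_gen_eqI)
  show "monic ` A \<subseteq> ideal_gen A"
    by (auto intro: ideal_gen_base)
  have "p \<in> ideal_gen (monic ` A)" if "p \<in> A" for p
    using monic_in_ideal_iff[of p "monic ` A"] ideal_gen_base[of "monic p" "monic ` A"] that
    by auto
  then show "A \<subseteq> ideal_gen (monic ` A)" by blast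
qed

lemma groebner_basis_monic:
  assumes "groebner_basis A I"
  shows "groebner_basis (monic ` A) I"
  using assms HM_monic unfolding groebner_basis_def ideal_gen_monic
  by (metis (no_types, lifting) finite_imageI image_eqI monic_eq_0_iff)

lemma groebner_basis_singleton:
  assumes "p \<noteq> 0"
  shows "groebner_basis {p} (ideal_gen {p})"
  unfolding groebner_basis_def
proof (intro conjI ballI impI)
  fix q
  assume q: "q \<in> ideal_gen {p}" "q \<noteq> 0"
  then obtain h where "q = h * p"
    by (blast elim: ideal_gen_singletonE)
  then show "\<exists>g\<in>{p}. g \<noteq> 0 \<and> mdvd (HM g) (HM q)"
    using assms q(2) HM_mult[of h p] by (cases "h = 0") (auto simp: mdvd_add)
qed simp_all

text \<open>\<open>p\<close> is \<open>q\<close> plus a multiple of the reductor \<open>g\<close>,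
  and \<open>g\<close> stays, so the ideal is unchanged. If the head term of \<open>p\<close> was
  the one cancelled, \<open>HM g\<close> divides \<open>HM p\<close> and takes its place; otherwise
  \<open>q\<close> keeps the head monomial of \<open>p\<close>.\<close>

lemma groebner_basis_interreduction_step:
  assumes "groebner_basis A I" and "0 \<notin> A" and "interreduction_step A A'"
  shows "groebner_basis A' I" and "0 \<notin> A'"
proof -
  obtain p q where p: "p \<in> A" and red: "reduces (A - {p}) p q"
    and A': "A' = insert q (A - {p}) - {0}"
    using assms(3) unfolding interreduction_step_def by blast
  obtain g t where g: "g \<in> A" "g \<noteq> p" "g \<noteq> 0" and t: "t \<in> Poly_Mapping.keys p" "mdvd (HM g) t"
    and q: "q = p - Poly_Mapping.single (t - HM g) (Poly_Mapping.lookup p t / HC g) * g"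
    using red unfolding reduces_def by blast
  define m where "m = Poly_Mapping.single (t - HM g) (Poly_Mapping.lookup p t / HC g)"
  have p0: "p \<noteq> 0" using p assms(2) by auto
  have gA': "g \<in> A'" using g by (simp add: A')
  show "0 \<notin> A'" by (simp add: A')
  have "q \<in> ideal_gen A"
    unfolding q by (intro ideal_gen_diff ideal_gen_mult ideal_gen_base p g(1))
  then have "A' \<subseteq> ideal_gen A"
    by (auto simp: A' intro: ideal_gen_base)
  moreover have "q \<in> ideal_gen A'"
    by (cases "q = 0") (auto simp: A' intro: ideal_gen_zero ideal_gen_base)
  then have "q + m * g \<in> ideal_gen A'"
    by (rule ideal_gen_add[OF _ ideal_gen_mult[OF ideal_gen_base[OF gA']]])
  then have "p \<in> ideal_gen A'"
    by (simp add: q m_def)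
  then have "A \<subseteq> ideal_gen A'"
    using assms(2) by (auto simp: A' intro: ideal_gen_base)
  ultimately have ideal: "ideal_gen A' = I"
    using ideal_gen_eqI[of A' A] assms(1) by (simp add: groebner_basis_def)
  have "\<exists>g\<in>A'. g \<noteq> 0 \<and> mdvd (HM g) (HM r)" if r: "r \<in> I" "r \<noteq> 0" for r
  proof -
    obtain a where a: "a \<in> A" "a \<noteq> 0" "mdvd (HM a) (HM r)"
      using assms(1) r unfolding groebner_basis_def by blast
    show ?thesis
    proof (cases "a = p")
      case False
      then show ?thesis using a by (auto simp: A')
    next
      case True
      show ?thesis
      proof (cases "t = HM p")
        case True
        then show ?thesis
          using gA' g(3) t(2) a(3) \<open>a = p\<close> mdvd_trans by blast
      next
        case False
        then have "t \<prec>\<^sub>T HM p"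
          using HM_greatest[OF t(1)] by simp
        moreover have "HM (m * g) = t"
          using single_mult(1)[of "Poly_Mapping.lookup p t / HC g" g "t - HM g"] g(3) t
          by (simp add: m_def in_keys_iff)
        ultimately have "below (HM p) (m * g)"
          by (simp add: HM_less_below)
        from diff_below(1,3)[OF p0 this] have "HM q = HM p" "q \<noteq> 0"
          by (simp_all add: q m_def)
        then show ?thesis
          using a \<open>a = p\<close> by (intro bexI[of _ q]) (auto simp: A')
      qed
    qed
  qed
  moreover have "finite A'"
    using assms(1) by (simp add: A' groebner_basis_def)
  ultimately show "groebner_basis A' I"
    using ideal by (simp add: groebner_basis_def)
qed

lemma ideal_gen_remove_zero: "ideal_gen (A - {0}) = ideal_gen A"
proof (rule ideal_gen_eqI)
  have "p \<in> ideal_gen (A - {0})" if "p \<in> A" for p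
    using that by (cases "p = 0") (auto intro: ideal_gen_zero ideal_gen_base)
  then show "A \<subseteq> ideal_gen (A - {0})" by blast
qed (auto intro: ideal_gen_base)

lemma groebner_basis_interreduction:
  assumes "groebner_basis A I" and "interreduction A B"
  shows "groebner_basis B I" and "0 \<notin> B"
proof -
  obtain B' where steps: "interreduction_step\<^sup>*\<^sup>* (A - {0}) B'" and B: "B = monic ` B'"
    using assms(2) unfolding interreduction_def by blast
  have "groebner_basis (A - {0}) I"
    using assms(1) by (auto simp: groebner_basis_def ideal_gen_remove_zero)
  with steps have "groebner_basis B' I \<and> 0 \<notin> B'"
    by (induction rule: rtranclp_induct) (auto dest: groebner_basis_interreduction_step)
  then show "groebner_basis B I" "0 \<notin> B"
    using groebner_basis_monic by (auto simp: B)
qed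

lemma reduces_mod_ideal:
  assumes "reduces B p q" and "B \<subseteq> ideal_gen S"
  shows "p - q \<in> ideal_gen S"
  using assms by (auto simp: reduces_def intro!: ideal_gen_mult)

lemma normal_form_mod_ideal:
  assumes "normal_form B p q" and "B \<subseteq> ideal_gen S"
  shows "p - q \<in> ideal_gen S"
proof -
  have "(reduces B)\<^sup>*\<^sup>* p q" using assms(1) by (simp add: normal_form_def)
  then show ?thesis
  proof (induction rule: rtranclp_induct)
    case base
    show ?case by (simp add: ideal_gen_zero)
  next
    case (step r q)
    have "(p - r) + (r - q) \<in> ideal_gen S"
      using step.IH reduces_mod_ideal[OF step.hyps(2) assms(2)] by (rule ideal_gen_add)
    then show ?case by simp
  qed
qed

section \<open>Signatures\<close>

text \<open>Only the cofactor of the new input is tracked; the older generators are absorbed into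
  \<open>ideal_gen S\<close>. \<open>p\<close> may be 0: then \<open>h * f\<close> lies in the old
  ideal, and the head monomial of \<open>h\<close> is the signature of a syzygy.\<close>

definition has_sig ::
    "('x, 'a::field) mpoly set \<Rightarrow> ('x, 'a) mpoly \<Rightarrow> 'x mon \<Rightarrow> ('x, 'a) mpoly \<Rightarrow> bool" where
  "has_sig S f \<tau> p \<longleftrightarrow> (\<exists>h. h \<noteq> 0 \<and> HM h = \<tau> \<and> p - h * f \<in> ideal_gen S)"

lemma has_sig_self: "has_sig S f 0 f"
proof -
  show ?thesis
    unfolding has_sig_def by (intro exI[of _ 1]) (simp add: ideal_gen_zero HM_one)
qed

lemma has_sig_single_mult:
  assumes "has_sig S f \<tau> p" and "c \<noteq> 0"
  shows "has_sig S f (u + \<tau>) (Poly_Mapping.single u c * p)"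
proof -
  obtain h where h: "h \<noteq> 0" "HM h = \<tau>" "p - h * f \<in> ideal_gen S"
    using assms(1) unfolding has_sig_def by blast
  have "Poly_Mapping.single u c * (p - h * f) \<in> ideal_gen S"
    by (rule ideal_gen_mult[OF h(3)])
  then show ?thesis
    using h single_mult[OF assms(2) h(1), of u] unfolding has_sig_def
    by (intro exI[of _ "Poly_Mapping.single u c * h"]) (simp add: algebra_simps)
qed

lemma has_sig_mod_ideal:
  assumes "has_sig S f \<tau> p" and "p - q \<in> ideal_gen S"
  shows "has_sig S f \<tau> q"
proof -
  obtain h where h: "h \<noteq> 0" "HM h = \<tau>" "p - h * f \<in> ideal_gen S"
    using assms(1) unfolding has_sig_def by blast
  have "(p - h * f) - (p - q) \<in> ideal_gen S"
    by (rule ideal_gen_diff[OF h(3) assms(2)])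
  then show ?thesis
    using h unfolding has_sig_def by auto
qed

text \<open>The strict inequality keeps the leading terms of the two cofactors from cancelling, so
  \<open>h - h'\<close> still has head monomial \<tau>.\<close>

lemma has_sig_diff_less:
  assumes "has_sig S f \<tau> p" and "has_sig S f \<tau>' q" and "\<tau>' \<prec>\<^sub>T \<tau>"
  shows "has_sig S f \<tau> (p - q)" and "has_sig S f \<tau> (q - p)"
proof -
  obtain h where h: "h \<noteq> 0" "HM h = \<tau>" "p - h * f \<in> ideal_gen S"
    using assms(1) unfolding has_sig_def by blast
  obtain h' where h': "HM h' = \<tau>'" "q - h' * f \<in> ideal_gen S"
    using assms(2) unfolding has_sig_def by blast
  have "(p - h * f) - (q - h' * f) \<in> ideal_gen S"
    by (rule ideal_gen_diff[OF h(3) h'(2)])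
  moreover have "below (HM h) h'"
    using h(2) h'(1) assms(3) by (simp add: HM_less_below)
  note diff_below[OF h(1) this]
  ultimately show *: "has_sig S f \<tau> (p - q)"
    using h(2) unfolding has_sig_def by (intro exI[of _ "h - h'"]) (simp add: algebra_simps)
  show "has_sig S f \<tau> (q - p)"
    using has_sig_single_mult[OF *, of "- 1" 0] by (simp add: single_uminus)
qed

lemma has_sig_monic: "has_sig S f \<tau> p \<Longrightarrow> has_sig S f \<tau> (monic p)"
  using has_sig_single_mult[of S f \<tau> p "1 / HC p" 0]
  by (cases "p = 0") (simp_all add: monic_def)

section \<open>The covering argument by induction on signatures\<close>

text \<open>Stated without reference to a state: \<open>canon k \<tau>\<close> chooses a multiple of
  \<open>P k\<close> at signature \<tau>, and \<open>tops \<sigma> t\<close> says that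
  \<open>t\<close> is the head monomial of a chosen multiple whose signature is not
  \<open>red\<close> and is at most \<sigma>. Any \<open>p\<close> of signature \<tau> differs from
  a scalar multiple of the chosen one by something with a cofactor below \<tau>;
  \<open>irred\<close> and \<open>irred_Gp\<close> forbid this difference to have the head monomial
  of the chosen multiple.\<close>

lemma rewrite_basis_covers:
  fixes N :: "nat set" and sg :: "nat \<Rightarrow> 'x mon" and P :: "nat \<Rightarrow> ('x, 'a::field) mpoly"
    and Gp S :: "('x, 'a) mpoly set" and canon :: "nat \<Rightarrow> 'x mon \<Rightarrow> bool"
  defines "red \<tau> \<equiv> \<exists>g\<in>Gp. mdvd (HM g) \<tau>"
  defines "tops \<sigma> t \<equiv> \<exists>l\<in>N. \<exists>v. P l \<noteq> 0 \<and> canon l (v + sg l) \<and> \<not> red (v + sg l) \<and>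
    (v + sg l \<prec>\<^sub>T \<sigma> \<or> v + sg l = \<sigma>) \<and> v + HM (P l) = t"
  assumes Gp: "Gp \<subseteq> ideal_gen S" "0 \<notin> Gp"
    and Gp_basis: "\<And>p. p \<in> ideal_gen S \<Longrightarrow> p \<noteq> 0 \<Longrightarrow> red (HM p)"
    and sig: "\<And>k. k \<in> N \<Longrightarrow> has_sig S f (sg k) (P k)"
    and canon: "\<And>\<tau>. \<exists>k\<in>N. canon k \<tau>" "\<And>k \<tau>. canon k \<tau> \<Longrightarrow> mdvd (sg k) \<tau>"
    and irred: "\<And>k \<tau> \<sigma>. k \<in> N \<Longrightarrow> canon k \<tau> \<Longrightarrow> \<not> red \<tau> \<Longrightarrow> P k \<noteq> 0 \<Longrightarrow> \<sigma> \<prec>\<^sub>T \<tau> \<Longrightarrow>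
      \<not> tops \<sigma> (\<tau> - sg k + HM (P k))"
    and irred_Gp: "\<And>k \<tau>. k \<in> N \<Longrightarrow> canon k \<tau> \<Longrightarrow> \<not> red \<tau> \<Longrightarrow> P k \<noteq> 0 \<Longrightarrow>
      \<not> red (\<tau> - sg k + HM (P k))"
    and p: "has_sig S f \<tau> p" "p \<noteq> 0"
  shows "red (HM p) \<or> tops \<tau> (HM p)"
  using p
proof (induction \<tau> arbitrary: p rule: wfp_induct_rule[OF wfp_less])
  case (1 \<tau> p)
  have tops_mono: "tops \<sigma> t \<Longrightarrow> \<sigma> \<prec>\<^sub>T \<tau> \<Longrightarrow> tops \<tau> t" for \<sigma> t
    unfolding tops_def using less_trans by blast
  \<comment> \<open>\<open>lower\<close> wraps the induction hypothesis: a cofactor below \<tau> is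
    either 0, and \<open>q\<close> lies in the old ideal, or has a smaller head monomial, to which
    induction applies.\<close>
  have lower: "red (HM q) \<or> (\<exists>\<sigma>. \<sigma> \<prec>\<^sub>T \<tau> \<and> tops \<sigma> (HM q))"
    if h: "below \<tau> h" "q - h * f \<in> ideal_gen S" "q \<noteq> 0" for q h
  proof (cases "h = 0")
    case True
    then show ?thesis using Gp_basis h by simp
  next
    case False
    then have "HM h \<prec>\<^sub>T \<tau>" "has_sig S f (HM h) q"
      using h below_HM_less unfolding has_sig_def by blast+
    then show ?thesis
      using "1.IH" h(3) by blast
  qed
  obtain h where h: "h \<noteq> 0" "HM h = \<tau>" "p - h * f \<in> ideal_gen S"
    using "1.prems"(1) unfolding has_sig_def by blast
  show ?case
  proof (cases "red \<tau>")
    case True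
    then obtain g where g: "g \<in> Gp" "mdvd (HM g) \<tau>"
      unfolding red_def by blast
    have g0: "g \<noteq> 0" using g(1) Gp(2) by auto
    \<comment> \<open>\<open>m * g\<close> copies the leading term of \<open>h\<close>. As
      \<open>m * g * f\<close> lies in the old ideal, \<open>h - m * g\<close> is another cofactor
      for the same \<open>p\<close>, and it lies below \<tau>.\<close>
    define m where "m = Poly_Mapping.single (\<tau> - HM g) (HC h / HC g)"
    have mg: "HM (m * g) = \<tau>" "HC (m * g) = HC h"
      using single_mult[of "HC h / HC g" g "\<tau> - HM g"] g(2) g0 h(1) by (simp_all add: m_def)
    have "m * g * f \<in> ideal_gen S"
      using ideal_gen_mult[of g S "m * f"] Gp(1) g(1) by (auto simp: ac_simps)
    from ideal_gen_add[OF h(3) this] have "p - (h - m * g) * f \<in> ideal_gen S"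
      by (simp add: algebra_simps)
    moreover have "below \<tau> (h - m * g)"
      using below_diff_eq_HM[of h "m * g"] mg h(2) by simp
    ultimately show ?thesis
      using lower "1.prems"(2) tops_mono by blast
  next
    case False
    obtain k where k: "k \<in> N" "canon k \<tau>" using canon(1) by blast
    define u where "u = \<tau> - sg k"
    have u: "u + sg k = \<tau>" using canon(2)[OF k(2)] by (simp add: u_def)
    obtain h' where h': "h' \<noteq> 0" "HM h' = sg k" "P k - h' * f \<in> ideal_gen S"
      using sig[OF k(1)] unfolding has_sig_def by blast
    \<comment> \<open>The coefficient is chosen such that \<open>m * h'\<close> and \<open>h\<close>
      share their leading term, which gives \<open>p - m * P k\<close> a cofactor below
      \<tau>.\<close>
    define m where "m = Poly_Mapping.single u (HC h / HC h')"
    have mh': "HM (m * h') = \<tau>" "HC (m * h') = HC h"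
      using single_mult[of "HC h / HC h'" h' u] h(1) h'(1,2) u by (simp_all add: m_def)
    have below: "below \<tau> (h - m * h')"
      using below_diff_eq_HM[of h "m * h'"] mh' h(2) by simp
    have diff: "(p - m * P k) - (h - m * h') * f \<in> ideal_gen S"
      using ideal_gen_diff[OF h(3) ideal_gen_mult[OF h'(3), of m]] by (simp add: algebra_simps)
    show ?thesis
    proof (cases "P k = 0")
      case True
      then show ?thesis
        using lower[OF below] diff "1.prems"(2) tops_mono by auto
    next
      case Pk: False
      have mP: "HM (m * P k) = u + HM (P k)" "m * P k \<noteq> 0"
        using single_mult[of "HC h / HC h'" "P k" u] h(1) h'(1) Pk by (simp_all add: m_def)
      consider "HM p \<prec>\<^sub>T u + HM (P k)" | "HM p = u + HM (P k)" | "u + HM (P k) \<prec>\<^sub>T HM p"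
        using less_cases by blast
      then show ?thesis
      proof cases
        \<comment> \<open>Here the difference would keep the head monomial of \<open>m * P k\<close>
          with a cofactor below \<tau>, against \<open>irred\<close> or
          \<open>irred_Gp\<close>.\<close>
        case 1
        then have "below (HM (m * P k)) p" using mP(1) by (simp add: HM_less_below)
        from diff_below(1,3)[OF mP(2) this]
        have "HM (m * P k - p) = u + HM (P k)" "m * P k - p \<noteq> 0"
          using mP(1) by simp_all
        moreover have "p - m * P k = Poly_Mapping.single 0 (- 1) * (m * P k - p)"
          by (simp add: single_uminus)
        ultimately have "HM (p - m * P k) = u + HM (P k)" "p - m * P k \<noteq> 0"
          using single_mult[of "- 1" "m * P k - p" 0] by simp_all
        then show ?thesis
          using lower[OF below diff] irred[OF k False Pk] irred_Gp[OF k False Pk]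
          unfolding u_def by metis
      next
        case 2
        then have "tops \<tau> (HM p)"
          unfolding tops_def using k u Pk False by (intro bexI[of _ k] exI[of _ u]) simp_all
        then show ?thesis ..
      next
        \<comment> \<open>Here the difference keeps the head monomial of \<open>p\<close>, so
          \<open>lower\<close> settles \<open>p\<close> itself.\<close>
        case 3
        then have "below (HM p) (m * P k)" using mP(1) by (simp add: HM_less_below)
        from diff_below(1,3)[OF "1.prems"(2) this] show ?thesis
          using lower[OF below diff] tops_mono by auto
      qed
    qed
  qed
qed

end

section \<open>Updates of the global data\<close>

lemma num_set_Poly [simp]: "num (set_Poly k p s) = num s"
  and rules_set_Poly [simp]: "rules (set_Poly k p s) = rules s"
  and num_append_labeled [simp]: "num (append_labeled \<sigma> p s) = Suc (num s)"
  and rules_append_labeled [simp]: "rules (append_labeled \<sigma> p s) = rules s"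
  and num_add_rule [simp]: "num (add_rule \<sigma> j s) = num s"
  and labeled_add_rule [simp]: "labeled (add_rule \<sigma> j s) = labeled s"
  by (simp_all add: num_def set_Poly_def append_labeled_def add_rule_def Let_def)

lemma Sig_add_rule [simp]: "Sig (add_rule \<sigma> j s) k = Sig s k"
  and Poly_add_rule [simp]: "Poly (add_rule \<sigma> j s) k = Poly s k"
  by (simp_all add: Sig_def Poly_def)

lemma Sig_set_Poly [simp]: "Sig (set_Poly k p s) j = Sig s j"
  by (cases "j - 1 = k - 1"; cases "k - 1 < length (labeled s)")
     (auto simp: Sig_def set_Poly_def list_update_beyond not_less)

lemma Poly_set_Poly:
  "1 \<le> k \<Longrightarrow> k \<le> num s \<Longrightarrow> 1 \<le> j \<Longrightarrow> Poly (set_Poly k p s) j = (if j = k then p else Poly s j)"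
  by (auto simp: Poly_def set_Poly_def num_def nth_list_update)

lemma is_rewritable_set_Poly [simp]: "is_rewritable (set_Poly k p s) u j = is_rewritable s u j"
  by (simp add: is_rewritable_def find_rewriting_def)

text \<open>S-polynomials and reductions by a larger signature both enter the state in this form, so
  every element created during a pass brings a rule of its own.\<close>

definition add_labeled ::
    "'x sig \<Rightarrow> ('x, 'a) mpoly \<Rightarrow> ('x, 'a::zero) state \<Rightarrow> ('x, 'a) state" where
  "add_labeled \<sigma> p s = add_rule \<sigma> (Suc (num s)) (append_labeled \<sigma> p s)"

lemma num_add_labeled [simp]: "num (add_labeled \<sigma> p s) = Suc (num s)"
  by (simp add: add_labeled_def)

lemma Sig_add_labeled:
  "1 \<le> j \<Longrightarrow> j \<le> Suc (num s) \<Longrightarrow>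
     Sig (add_labeled \<sigma> p s) j = (if j = Suc (num s) then \<sigma> else Sig s j)"
  and Poly_add_labeled:
  "1 \<le> j \<Longrightarrow> j \<le> Suc (num s) \<Longrightarrow>
     Poly (add_labeled \<sigma> p s) j = (if j = Suc (num s) then p else Poly s j)"
  by (auto simp: Sig_def Poly_def add_labeled_def append_labeled_def num_def nth_append)

lemma rules_add_labeled:
  "rules (add_labeled \<sigma> p s) =
     (rules s)[snd \<sigma> - 1 := rules s ! (snd \<sigma> - 1) @ [(fst \<sigma>, Suc (num s))]]"
  by (simp add: add_labeled_def add_rule_def Let_def)

text \<open>Rules are searched from the end. If the added rule matches, the search returns the fresh
  index, which is not \<open>k\<close>; otherwise the former result stands.\<close>

lemma is_rewritable_add_labeled:
  assumes "is_rewritable s u k" and "1 \<le> k" and "k \<le> num s"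
  shows "is_rewritable (add_labeled \<sigma> p s) u k"
  using assms
  by (cases "snd \<sigma> - 1 < length (rules s)")
     (auto simp: is_rewritable_def find_rewriting_def Sig_add_labeled rules_add_labeled
        nth_list_update list_update_beyond not_less split: option.splits)

lemma is_rewritable_by_added:
  assumes "1 \<le> k" and "k \<le> num s" and "snd (Sig s k) = snd \<sigma>"
    and "snd \<sigma> - 1 < length (rules s)" and "mdvd (fst \<sigma>) (u + fst (Sig s k))"
  shows "is_rewritable (add_labeled \<sigma> p s) u k"
  using assms
  by (auto simp: is_rewritable_def find_rewriting_def Sig_add_labeled rules_add_labeled)

text \<open>Relates an earlier state to a later one. Signatures never change and rewritability only
  grows, but polynomials are frozen on \<open>K\<close> alone, since those still under reduction
  keep changing.\<close>

definition extends :: "nat set \<Rightarrow> ('x, 'a::zero) state \<Rightarrow> ('x, 'a) state \<Rightarrow> bool" where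
  "extends K s s' \<longleftrightarrow> num s \<le> num s' \<and> K \<subseteq> {1..num s} \<and>
     (\<forall>k\<in>{1..num s}. Sig s' k = Sig s k \<and> (\<forall>u. is_rewritable s u k \<longrightarrow> is_rewritable s' u k)) \<and>
     (\<forall>k\<in>K. Poly s' k = Poly s k)"

lemma extends_refl: "K \<subseteq> {1..num s} \<Longrightarrow> extends K s s"
  by (simp add: extends_def)

lemma extends_trans: "extends K s s' \<Longrightarrow> extends K s' s'' \<Longrightarrow> extends K s s''"
  by (auto simp: extends_def)

lemma extends_subset: "extends K s s' \<Longrightarrow> K' \<subseteq> K \<Longrightarrow> extends K' s s'"
  by (auto simp: extends_def)

lemma extends_set_Poly:
  "K \<subseteq> {1..num s} \<Longrightarrow> k \<in> {1..num s} \<Longrightarrow> k \<notin> K \<Longrightarrow> extends K s (set_Poly k p s)"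
  by (auto simp: extends_def Poly_set_Poly subset_iff)

lemma extends_add_labeled: "K \<subseteq> {1..num s} \<Longrightarrow> extends K s (add_labeled \<sigma> p s)"
  unfolding extends_def
  by (auto simp: Sig_add_labeled Poly_add_labeled is_rewritable_add_labeled subset_iff)

lemma find_Some_mono:
  assumes "find P xs = Some x" and "Q x" and "\<And>y. y \<in> set xs \<Longrightarrow> Q y \<Longrightarrow> P y"
  shows "find Q xs = Some x"
  using assms by (induction xs) (auto split: if_splits)

section \<open>One call of the incremental step\<close>

text \<open>\<open>s0\<close> is the state at the start of the pass, with the empty rule list of the
  new input already appended. Indices below \<open>i\<close> hold the old basis, \<open>i\<close>
  holds the new input, and larger ones arise during the pass. \<open>prev_rules\<close> describes
  the phantom rules: \<sigma> is the cofactor of \<open>l\<close> in a pair with an earlier old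
  element.\<close>

locale f5c_pass = monomial_order less_mon
  for less_mon :: "'x::finite mon \<Rightarrow> 'x mon \<Rightarrow> bool"  (infix \<open>\<prec>\<^sub>T\<close> 50) +
  fixes i :: nat and Gprev :: "nat set" and B S :: "('x, 'a::field) mpoly set"
    and f :: "('x, 'a) mpoly" and s0 :: "('x, 'a) state"
  assumes Gprev: "Gprev = {1..<i}" and i_pos: "1 \<le> i"
    and B: "B \<subseteq> ideal_gen S"
    and f: "f \<noteq> 0"
    and basis: "groebner_basis (Poly s0 ` Gprev) (ideal_gen S)"
    and prev_nonzero: "j \<in> Gprev \<Longrightarrow> Poly s0 j \<noteq> 0"
    and num_init: "num s0 = i" and Sig_init: "j \<in> {1..i} \<Longrightarrow> Sig s0 j = (0, j)"
    and Poly_init: "Poly s0 i = f"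
    and rules_init: "length (rules s0) = i" "rules s0 ! (i - 1) = []"
    and prev_rules: "l \<in> Gprev \<Longrightarrow> (\<sigma>, j') \<in> set (rules s0 ! (l - 1)) \<Longrightarrow>
      \<exists>j\<in>{1..<l}. \<sigma> + HM (Poly s0 l) = mlcm (HM (Poly s0 j)) (HM (Poly s0 l))"
begin

section \<open>The state invariant of a pass\<close>

text \<open>The last two clauses match the rules of index \<open>i\<close> with the elements beyond
  \<open>i\<close>, zero or not, each rule carrying exactly the signature of its element. The input
  \<open>i\<close> itself has no rule.\<close>

definition valid :: "('x, 'a) state \<Rightarrow> bool" where
  "valid s \<longleftrightarrow> i \<le> num s \<and> length (rules s) = i \<and> Poly s i = f \<and>
     (\<forall>j\<in>{1..i}. Sig s j = (0, j)) \<and>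
     (\<forall>j\<in>Gprev. Poly s j = Poly s0 j \<and> rules s ! (j - 1) = rules s0 ! (j - 1)) \<and>
     (\<forall>j\<in>{i..num s}. snd (Sig s j) = i \<and> has_sig S f (fst (Sig s j)) (Poly s j)) \<and>
     (\<forall>(\<tau>, j)\<in>set (rules s ! (i - 1)). j \<in> {i<..num s} \<and> \<tau> = fst (Sig s j)) \<and>
     (\<forall>j\<in>{i<..num s}. (fst (Sig s j), j) \<in> set (rules s ! (i - 1)))"

lemma validD:
  assumes "valid s"
  shows "i \<le> num s" and "length (rules s) = i" and "Poly s i = f"
    and "j \<in> {1..i} \<Longrightarrow> Sig s j = (0, j)"
    and "j \<in> Gprev \<Longrightarrow> Poly s j = Poly s0 j"
    and "j \<in> Gprev \<Longrightarrow> rules s ! (j - 1) = rules s0 ! (j - 1)"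
    and "j \<in> {i..num s} \<Longrightarrow> snd (Sig s j) = i"
    and "j \<in> {i..num s} \<Longrightarrow> has_sig S f (fst (Sig s j)) (Poly s j)"
    and "(\<tau>, j) \<in> set (rules s ! (i - 1)) \<Longrightarrow> j \<in> {i<..num s} \<and> \<tau> = fst (Sig s j)"
    and "j \<in> {i<..num s} \<Longrightarrow> (fst (Sig s j), j) \<in> set (rules s ! (i - 1))"
  using assms unfolding valid_def by auto

lemma valid_init: "valid s0"
  using i_pos Poly_init num_init Sig_init rules_init has_sig_self[of S f]
  by (auto simp: valid_def)

lemma new_iff:
  assumes "valid s" and "k \<in> {1..num s}"
  shows "i \<le> k \<longleftrightarrow> snd (Sig s k) = i" and "snd (Sig s k) \<le> i"
  using assms validD(4,7)[OF assms(1), of k] by (cases "i \<le> k"; force)+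

lemma prev_in_ideal: "valid s \<Longrightarrow> j \<in> Gprev \<Longrightarrow> Poly s j \<in> ideal_gen S"
  using validD(5)[of s j] basis ideal_gen_base[of "Poly s0 j" "Poly s0 ` Gprev"]
  by (simp add: groebner_basis_def)

lemma prev_or_new: "j \<in> {1..num s} \<Longrightarrow> j \<in> Gprev \<or> j \<in> {i..num s}"
  by (auto simp: Gprev)

text \<open>The multiple of \<open>j\<close> lies in the old ideal or has a cofactor of smaller head
  monomial, so the cofactor of the multiple of \<open>k\<close> decides. Both orders of subtraction
  occur: in a reduction the larger signature may belong to the reductor.\<close>

lemma has_sig_combine:
  assumes "valid s" and k: "k \<in> {1..num s}" and j: "j \<in> {1..num s}"
    and "c \<noteq> 0" and "d \<noteq> 0" and new: "snd (Sig s k) = i"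
    and less: "sig_mult w (Sig s j) \<prec>\<^sub>S sig_mult u (Sig s k)"
  shows "has_sig S f (u + fst (Sig s k))
           (Poly_Mapping.single u c * Poly s k - Poly_Mapping.single w d * Poly s j)"
    and "has_sig S f (u + fst (Sig s k))
           (Poly_Mapping.single w d * Poly s j - Poly_Mapping.single u c * Poly s k)"
proof -
  define p where "p = Poly_Mapping.single u c * Poly s k"
  define q where "q = Poly_Mapping.single w d * Poly s j"
  have "k \<in> {i..num s}" using new_iff(1)[OF assms(1) k] new k by simp
  then have p: "has_sig S f (u + fst (Sig s k)) p"
    unfolding p_def by (intro has_sig_single_mult validD(8) assms(1,4))
  have *: "has_sig S f (u + fst (Sig s k)) (p - q)"
  proof (cases "j \<in> Gprev")
    case True
    then have "q \<in> ideal_gen S"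
      unfolding q_def by (intro ideal_gen_mult prev_in_ideal assms(1))
    then show ?thesis
      by (intro has_sig_mod_ideal[OF p]) simp
  next
    case False
    then have j: "j \<in> {i..num s}" using prev_or_new[OF j] by simp
    then have "has_sig S f (w + fst (Sig s j)) q"
      unfolding q_def by (intro has_sig_single_mult validD(8) assms(1,5))
    moreover have "w + fst (Sig s j) \<prec>\<^sub>T u + fst (Sig s k)"
      using less validD(7)[OF assms(1) j] new by (simp add: sig_less_def sig_mult_def)
    ultimately show ?thesis
      using has_sig_diff_less(1)[OF p] by blast
  qed
  then show "has_sig S f (u + fst (Sig s k)) (Poly_Mapping.single u c * Poly s k -
      Poly_Mapping.single w d * Poly s j)"
    by (simp add: p_def q_def)
  have "has_sig S f (u + fst (Sig s k)) (Poly_Mapping.single 0 (- 1) * (p - q))"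
    using has_sig_single_mult[OF *, of "- 1" 0] by simp
  then show "has_sig S f (u + fst (Sig s k)) (Poly_Mapping.single w d * Poly s j -
      Poly_Mapping.single u c * Poly s k)"
    by (simp add: p_def q_def single_uminus)
qed

lemma valid_set_Poly:
  assumes "valid s" and "k \<in> {i<..num s}" and "has_sig S f (fst (Sig s k)) p"
  shows "valid (set_Poly k p s)"
  using assms i_pos unfolding valid_def
  by (auto simp: Poly_set_Poly Gprev)

lemma valid_add_labeled:
  assumes "valid s" and "has_sig S f \<tau> p"
  shows "valid (add_labeled (\<tau>, i) p s)"
  using assms i_pos unfolding valid_def
  by (auto simp: Poly_add_labeled Sig_add_labeled rules_add_labeled Gprev nth_list_update
      le_Suc_eq greaterThanAtMost_iff)

text \<open>A rule dividing the common signature would have to point to both \<open>k\<close> and \<open>l\<close>; without such a rule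
  both equal \<open>i\<close>, the only new index with no rule of its own.\<close>

lemma nonrewritable_unique:
  assumes "valid s" and k: "k \<in> {i..num s}" and l: "l \<in> {i..num s}"
    and nr: "\<not> is_rewritable s u k" "\<not> is_rewritable s v l"
    and eq: "u + fst (Sig s k) = v + fst (Sig s l)"
  shows "k = l"
proof (cases "find (\<lambda>(\<tau>, j). mdvd \<tau> (u + fst (Sig s k))) (rev (rules s ! (i - 1)))")
  case (Some x)
  then show ?thesis
    using nr eq validD(7)[OF assms(1) k] validD(7)[OF assms(1) l]
    by (auto simp: is_rewritable_def find_rewriting_def split: prod.splits)
next
  case None
  have root: "j = i" if "j \<in> {i..num s}" "mdvd (fst (Sig s j)) (u + fst (Sig s k))" for j
  proof (rule ccontr)
    assume "j \<noteq> i"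
    then have "(fst (Sig s j), j) \<in> set (rules s ! (i - 1))"
      using that(1) by (intro validD(10)[OF assms(1)]) simp
    then show False
      using None that(2) by (auto simp: find_None_iff)
  qed
  have "k = i" using root[OF k] by (simp add: mdvd_add)
  moreover have "l = i" using root[OF l] unfolding eq by (simp add: mdvd_add)
  ultimately show ?thesis by simp
qed

section \<open>Existence and inheritance of non-rewritable multiples\<close>

text \<open>The search depends on \<tau> alone, so the element named by the last matching rule is
  not rewritable at \<tau>. Without a match the input \<open>i\<close>, whose signature monomial is
  1, serves.\<close>

lemma ex_nonrewritable:
  assumes "valid s"
  shows "\<exists>k\<in>{i..num s}. mdvd (fst (Sig s k)) \<tau> \<and> \<not> is_rewritable s (\<tau> - fst (Sig s k)) k"
proof (cases "find (\<lambda>(\<sigma>, j). mdvd \<sigma> \<tau>) (rev (rules s ! (i - 1)))")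
  case None
  have "Sig s i = (0, i)" using validD(4)[OF assms] i_pos by simp
  then show ?thesis
    using None validD(1)[OF assms] i_pos
    by (intro bexI[of _ i]) (auto simp: is_rewritable_def find_rewriting_def mdvd_def)
next
  case (Some x)
  obtain \<sigma> j where x: "x = (\<sigma>, j)" by (cases x)
  with Some have "(\<sigma>, j) \<in> set (rules s ! (i - 1))" and dvd: "mdvd \<sigma> \<tau>"
    by (metis (no_types, lifting) case_prod_conv find_Some_iff nth_mem set_rev)+
  then have j: "j \<in> {i..num s}" and \<sigma>: "\<sigma> = fst (Sig s j)"
    using validD(9)[OF assms] by force+
  then show ?thesis
    using Some x dvd validD(7)[OF assms j]
    by (intro bexI[of _ j]) (auto simp: is_rewritable_def find_rewriting_def)
qed

text \<open>Either no rule matches for \<open>u\<close>, and then none does for a divisor, or the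
  last match is the rule of \<open>k\<close> itself. For \<open>u'\<close> no further rules match,
  and the rule of \<open>k\<close> still does, because its monomial is that of
  \<open>Sig s k\<close>.\<close>

lemma nonrewritable_mdvd:
  assumes "valid s" and k: "k \<in> {i..num s}" and "\<not> is_rewritable s u k" and "mdvd u' u"
  shows "\<not> is_rewritable s u' k"
proof -
  let ?\<tau> = "fst (Sig s k)"
  have dvd: "mdvd \<sigma> (u + ?\<tau>)" if "mdvd \<sigma> (u' + ?\<tau>)" for \<sigma>
    using mdvd_trans[OF that, of "u + ?\<tau>"] assms(4) by simp
  have snd: "snd (Sig s k) = i" by (rule validD(7)[OF assms(1) k])
  show ?thesis
  proof (cases "find (\<lambda>(\<sigma>, j). mdvd \<sigma> (u + ?\<tau>)) (rev (rules s ! (i - 1)))")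
    case None
    then have "find (\<lambda>(\<sigma>, j). mdvd \<sigma> (u' + ?\<tau>)) (rev (rules s ! (i - 1))) = None"
      using dvd by (auto simp: find_None_iff)
    then show ?thesis
      by (simp add: is_rewritable_def find_rewriting_def snd)
  next
    case (Some x)
    obtain \<sigma> where x: "x = (\<sigma>, k)"
      using assms(3) Some
      by (cases x) (auto simp: is_rewritable_def find_rewriting_def snd)
    have "x \<in> set (rules s ! (i - 1))"
      using Some by (metis (no_types, lifting) find_Some_iff nth_mem set_rev)
    then have "\<sigma> = ?\<tau>"
      using validD(9)[OF assms(1)] x by blast
    then have "find (\<lambda>(\<sigma>, j). mdvd \<sigma> (u' + ?\<tau>)) (rev (rules s ! (i - 1))) = Some x"
      using dvd x by (intro find_Some_mono[OF Some]) (auto simp: mdvd_add)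
    then show ?thesis
      by (simp add: is_rewritable_def find_rewriting_def snd x)
  qed
qed

text \<open>By \<open>prev_rules\<close> the matching rule times \<open>HM (Poly s l)\<close> is an
  lcm with the head monomial of an earlier old element.\<close>

lemma prev_rewritable:
  assumes "valid s" and l: "l \<in> Gprev" and "is_rewritable s v l"
  shows "\<exists>j\<in>Gprev. j < l \<and> mdvd (HM (Poly s j)) (v + HM (Poly s l))"
proof -
  have Sig: "Sig s l = (0, l)"
    using validD(4)[OF assms(1)] l by (simp add: Gprev)
  then obtain x where "find (\<lambda>(\<tau>, j). mdvd \<tau> v) (rev (rules s ! (l - 1))) = Some x"
    using assms(3) by (auto simp: is_rewritable_def find_rewriting_def split: option.splits)
  then have "x \<in> set (rules s ! (l - 1))" and dvd: "mdvd (fst x) v"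
    by (metis (no_types, lifting) case_prod_unfold find_Some_iff nth_mem set_rev)+
  then have "(fst x, snd x) \<in> set (rules s0 ! (l - 1))"
    using validD(6)[OF assms(1) l] by simp
  from prev_rules[OF l this] obtain j where j: "j \<in> {1..<l}"
    "fst x + HM (Poly s0 l) = mlcm (HM (Poly s0 j)) (HM (Poly s0 l))" by blast
  then have "j \<in> Gprev" using l by (simp add: Gprev)
  have "mdvd (HM (Poly s0 j)) (fst x + HM (Poly s0 l))"
    unfolding j(2) by simp
  moreover have "mdvd (fst x + HM (Poly s0 l)) (v + HM (Poly s0 l))"
    using dvd by simp
  ultimately have "mdvd (HM (Poly s0 j)) (v + HM (Poly s0 l))"
    by (rule mdvd_trans)
  then show ?thesis
    using \<open>j \<in> Gprev\<close> j(1) l validD(5)[OF assms(1)] by auto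
qed

subsection \<open>Critical pairs\<close>

definition cofactor :: "('x, 'a) state \<Rightarrow> nat \<Rightarrow> nat \<Rightarrow> 'x mon" where
  "cofactor s k l = mlcm (HM (Poly s k)) (HM (Poly s l)) - HM (Poly s k)"

definition pair :: "('x, 'a) state \<Rightarrow> nat \<Rightarrow> nat \<Rightarrow> 'x cpair" where
  "pair s k l = (mlcm (HM (Poly s k)) (HM (Poly s l)), k, cofactor s k l, l, cofactor s l k)"

definition syzygy :: "('x, 'a) state \<Rightarrow> nat \<Rightarrow> nat \<Rightarrow> bool" where
  "syzygy s k l \<longleftrightarrow> snd (Sig s k) = i \<and>
     top_reducible_by s Gprev (cofactor s k l + fst (Sig s k))"

definition dead :: "('x, 'a) state \<Rightarrow> nat \<Rightarrow> nat \<Rightarrow> bool" where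
  "dead s k l \<longleftrightarrow> syzygy s k l \<or> syzygy s l k \<or>
     is_rewritable s (cofactor s k l) k \<or> is_rewritable s (cofactor s l k) l"

definition wf_pair :: "('x, 'a) state \<Rightarrow> nat set \<Rightarrow> 'x cpair \<Rightarrow> bool" where
  "wf_pair s G c \<longleftrightarrow> (\<exists>k\<in>G. \<exists>l\<in>G. c = pair s k l \<and> k \<noteq> l \<and> snd (Sig s k) = i \<and>
     \<not> sig_mult (cofactor s k l) (Sig s k) \<prec>\<^sub>S sig_mult (cofactor s l k) (Sig s l))"

text \<open>Pairs of two old elements are exempt, the old elements forming a Groebner basis already;
  pairs of a new element with an old one count.\<close>

definition covered :: "('x, 'a) state \<Rightarrow> 'x cpair set \<Rightarrow> nat set \<Rightarrow> bool" where
  "covered s P G \<longleftrightarrow> (\<forall>k\<in>G. \<forall>l\<in>G. k \<noteq> l \<longrightarrow> i \<le> k \<longrightarrow>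
     dead s k l \<or> pair s k l \<in> P \<or> pair s l k \<in> P)"

text \<open>\<open>T\<close> is the to-do list of the reduction.\<close>

definition accounted :: "('x, 'a) state \<Rightarrow> nat set \<Rightarrow> nat set \<Rightarrow> bool" where
  "accounted s G T \<longleftrightarrow> {1..i} \<subseteq> G \<and> G \<subseteq> {1..num s} \<and> T \<subseteq> {i<..num s} \<and> G \<inter> T = {} \<and>
     (\<forall>j\<in>G. Poly s j \<noteq> 0) \<and> (\<forall>j\<in>{i..num s}. j \<in> G \<or> j \<in> T \<or> Poly s j = 0)"

lemma dead_commute: "dead s k l = dead s l k"
  by (auto simp: dead_def)

lemma critical_pair_eq:
  "critical_pair s k l i Gprev =
     (if syzygy s k l \<or> syzygy s l k then {}
      else if sig_mult (cofactor s k l) (Sig s k) \<prec>\<^sub>S sig_mult (cofactor s l k) (Sig s l)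
      then {pair s l k} else {pair s k l})"
  by (simp add: critical_pair_def syzygy_def cofactor_def pair_def Let_def case_prod_unfold
      mlcm_commute[of "HM (Poly s l)"])

lemma extends_pair:
  assumes "extends G s s'" and "k \<in> G" and "l \<in> G"
  shows "cofactor s' k l = cofactor s k l" and "pair s' k l = pair s k l"
  using assms by (simp_all add: extends_def cofactor_def pair_def)

lemma wf_pair_extends:
  assumes "extends G s s'" and "wf_pair s G c"
  shows "wf_pair s' G c"
proof -
  have "Sig s' k = Sig s k" if "k \<in> G" for k
    using assms(1) that by (auto simp: extends_def)
  then show ?thesis
    using assms(2) extends_pair[OF assms(1)] unfolding wf_pair_def by metis
qed

lemma wf_pair_mono: "wf_pair s G c \<Longrightarrow> G \<subseteq> G' \<Longrightarrow> wf_pair s G' c"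
  unfolding wf_pair_def by blast

text \<open>All that \<open>dead\<close> refers to is frozen by \<open>extends\<close>, apart from
  rewritability, which only grows. The syzygy criterion looks at the old basis, whence
  \<open>Gprev \<subseteq> G\<close>.\<close>

lemma dead_extends:
  assumes ext: "extends G s s'" and "Gprev \<subseteq> G" and k: "k \<in> G" and l: "l \<in> G" and "dead s k l"
  shows "dead s' k l"
proof -
  have Sig: "Sig s' j = Sig s j" and "Poly s' j = Poly s j"
    and rew: "is_rewritable s u j \<Longrightarrow> is_rewritable s' u j"
    if "j \<in> G" for j u
    using ext that by (auto simp: extends_def)
  then have "top_reducible_by s' Gprev t = top_reducible_by s Gprev t" for t
    using assms(2) by (auto simp: top_reducible_by_def subset_iff)
  then show ?thesis
    using assms(5) Sig[OF k] Sig[OF l] rew[OF k] rew[OF l]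
      extends_pair[OF ext k l] extends_pair[OF ext l k]
    by (auto simp: dead_def syzygy_def)
qed

lemma covered_extends:
  assumes ext: "extends G s s'" and "Gprev \<subseteq> G" and "covered s P G"
    and "\<And>k l. k \<in> G \<Longrightarrow> l \<in> G \<Longrightarrow> pair s k l \<in> P - P' \<Longrightarrow> dead s' k l"
  shows "covered s' P' G"
  unfolding covered_def
proof (intro ballI impI)
  fix k l
  assume kl: "k \<in> G" "l \<in> G" "k \<noteq> l" "i \<le> k"
  then consider "dead s k l" | "pair s k l \<in> P" | "pair s l k \<in> P"
    using assms(3) unfolding covered_def by blast
  then show "dead s' k l \<or> pair s' k l \<in> P' \<or> pair s' l k \<in> P'"
    using dead_extends[OF ext assms(2) kl(1,2)] assms(4)[OF kl(1,2)] assms(4)[OF kl(2,1)]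
      extends_pair(2)[OF ext kl(1,2)] extends_pair(2)[OF ext kl(2,1)] dead_commute[of s' k l]
    by cases auto
qed

section \<open>Computation of the S-polynomials\<close>

text \<open>A pair is either skipped because a component is rewritable already, or it adds a rule
  that makes its first component rewritable; \<open>extends\<close> carries this to the end of the
  run.\<close>

lemma compute_spols_list_correct:
  assumes "compute_spols_list ps s T = (s', T')" and "valid s" and "G \<subseteq> {1..num s}"
    and "\<And>k. k \<in> G \<Longrightarrow> Poly s k \<noteq> 0" and "\<And>c. c \<in> set ps \<Longrightarrow> wf_pair s G c"
  shows "valid s' \<and> extends {1..num s} s s' \<and>
    set T' = set T \<union> {j \<in> {num s<..num s'}. Poly s' j \<noteq> 0} \<and>
    (\<forall>k l. pair s k l \<in> set ps \<longrightarrow>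
       is_rewritable s' (cofactor s k l) k \<or> is_rewritable s' (cofactor s l k) l)"
  using assms
proof (induction ps arbitrary: s T)
  case Nil
  then show ?case by (auto simp: extends_refl)
next
  case (Cons c ps)
  obtain k l where kl: "k \<in> G" "l \<in> G" "k \<noteq> l" and c: "c = pair s k l"
    and new: "snd (Sig s k) = i"
    and nless: "\<not> sig_mult (cofactor s k l) (Sig s k) \<prec>\<^sub>S sig_mult (cofactor s l k) (Sig s l)"
    using Cons.prems(5)[of c] by (auto simp: wf_pair_def)
  have mem: "k \<in> {1..num s}" "l \<in> {1..num s}" using kl Cons.prems(3) by auto
  let ?u = "cofactor s k l" and ?v = "cofactor s l k"
  have pair_c: "pair s k' l' = c \<longleftrightarrow> k' = k \<and> l' = l" for k' l'
    unfolding c by (auto simp: pair_def)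
  show ?case
  proof (cases "is_rewritable s ?u k \<or> is_rewritable s ?v l")
    case True
    then have rec: "compute_spols_list ps s T = (s', T')"
      using Cons.prems(1) by (auto simp: c pair_def)
    note IH = Cons.IH[OF rec Cons.prems(2,3,4)]
    have "valid s' \<and> extends {1..num s} s s' \<and>
        set T' = set T \<union> {j \<in> {num s<..num s'}. Poly s' j \<noteq> 0} \<and>
        (\<forall>k l. pair s k l \<in> set ps \<longrightarrow>
           is_rewritable s' (cofactor s k l) k \<or> is_rewritable s' (cofactor s l k) l)"
      by (rule IH) (use Cons.prems(5) in auto)
    moreover from this have "is_rewritable s' ?u k \<or> is_rewritable s' ?v l"
      using True mem by (auto simp: extends_def)
    ultimately show ?thesis
      using pair_c by auto
  next
    case False
    define p where "p = S_poly (Poly s k) (Poly s l)"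
    define \<sigma> where "\<sigma> = sig_mult ?u (Sig s k)"
    define s2 where "s2 = add_labeled \<sigma> p s"
    define T2 where "T2 = (if p \<noteq> 0 then T @ [Suc (num s)] else T)"
    have rec: "compute_spols_list ps s2 T2 = (s', T')"
      using Cons.prems(1) False
      by (simp add: c pair_def Let_def s2_def T2_def add_labeled_def p_def \<sigma>_def split: if_splits)
    have \<sigma>: "\<sigma> = (?u + fst (Sig s k), i)"
      by (simp add: \<sigma>_def sig_mult_def new)
    \<comment> \<open>With equal signatures \<open>nonrewritable_unique\<close> would give
      \<open>k = l\<close>. Hence the first component has the strictly larger signature, as
      \<open>has_sig_combine\<close> requires.\<close>
    have "?v + fst (Sig s l) \<noteq> ?u + fst (Sig s k)" if "snd (Sig s l) = i"
      using nonrewritable_unique[OF Cons.prems(2), of k l ?u ?v] False kl(3)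
        new_iff(1)[OF Cons.prems(2) mem(1)] new_iff(1)[OF Cons.prems(2) mem(2)] new that mem
      by auto
    then have less: "sig_mult ?v (Sig s l) \<prec>\<^sub>S sig_mult ?u (Sig s k)"
      using nless new new_iff(2)[OF Cons.prems(2) mem(2)]
        less_cases[of "?v + fst (Sig s l)" "?u + fst (Sig s k)"]
      by (auto simp: sig_less_def sig_mult_def)
    have "p = Poly_Mapping.single ?u (HC (Poly s l)) * Poly s k -
        Poly_Mapping.single ?v (HC (Poly s k)) * Poly s l"
      by (simp add: p_def S_poly_def Let_def cofactor_def mlcm_commute[of "HM (Poly s l)"])
    then have sig: "has_sig S f (?u + fst (Sig s k)) p"
      using has_sig_combine(1)[OF Cons.prems(2) mem _ _ new less] Cons.prems(4) kl by simp
    have valid: "valid s2"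
      unfolding s2_def \<sigma> by (rule valid_add_labeled[OF Cons.prems(2) sig])
    have ext: "extends {1..num s} s s2"
      unfolding s2_def by (rule extends_add_labeled) simp
    have ext_G: "extends G s s2" by (rule extends_subset[OF ext Cons.prems(3)])
    have num2: "num s2 = Suc (num s)" by (simp add: s2_def)
    have Poly2: "Poly s2 (Suc (num s)) = p" by (simp add: s2_def Poly_add_labeled)
    have "\<And>k. k \<in> G \<Longrightarrow> Poly s2 k \<noteq> 0"
      using ext_G Cons.prems(4) by (simp add: extends_def)
    moreover have "wf_pair s2 G c'" if "c' \<in> set ps" for c'
      using Cons.prems(5) that wf_pair_extends[OF ext_G] by simp
    moreover have "G \<subseteq> {1..num s2}" using Cons.prems(3) num2 by auto
    ultimately have IH: "valid s'" "extends {1..num s2} s2 s'"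
      "set T' = set T2 \<union> {j \<in> {num s2<..num s'}. Poly s' j \<noteq> 0}"
      "\<And>k l. pair s2 k l \<in> set ps \<Longrightarrow>
         is_rewritable s' (cofactor s2 k l) k \<or> is_rewritable s' (cofactor s2 l k) l"
      using Cons.IH[OF rec valid] by blast+
    have ext': "extends {1..num s} s s'"
      by (rule extends_trans[OF ext extends_subset[OF IH(2)]]) (simp add: num2)
    have "Poly s' (Suc (num s)) = p" "Suc (num s) \<le> num s'"
      using IH(2) Poly2 num2 by (simp_all add: extends_def)
    then have "{j \<in> {num s<..num s'}. Poly s' j \<noteq> 0} =
        (if p \<noteq> 0 then {Suc (num s)} else {}) \<union> {j \<in> {num s2<..num s'}. Poly s' j \<noteq> 0}"
      using num2 by (auto simp: Suc_le_eq le_less) (metis Suc_lessI)+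
    then have set: "set T' = set T \<union> {j \<in> {num s<..num s'}. Poly s' j \<noteq> 0}"
      unfolding IH(3) T2_def by auto
    \<comment> \<open>The rule just added carries the signature of this very multiple of
      \<open>k\<close>, so it matches and names the fresh index.\<close>
    have "is_rewritable s2 ?u k"
      unfolding s2_def
      by (rule is_rewritable_by_added)
         (use mem new validD(2)[OF Cons.prems(2)] i_pos in \<open>auto simp: \<sigma>\<close>)
    then have rew: "is_rewritable s' ?u k"
      using IH(2) mem num2 by (auto simp: extends_def)
    have "is_rewritable s' (cofactor s k' l') k' \<or> is_rewritable s' (cofactor s l' k') l'"
      if "pair s k' l' \<in> set (c # ps)" for k' l'
    proof (cases "pair s k' l' = c")
      case True
      then show ?thesis using rew pair_c by simp
    next
      case False
      then have "pair s k' l' \<in> set ps" using that by simp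
      moreover from this have "k' \<in> G" "l' \<in> G"
        using Cons.prems(5)[of "pair s k' l'"] by (auto simp: wf_pair_def pair_def)
      ultimately show ?thesis
        using IH(4)[of k' l'] extends_pair[OF ext_G] by simp
    qed
    then show ?thesis
      using IH(1) ext' set by blast
  qed
qed

section \<open>Top-reduction and the reduction loop\<close>

lemma find_reductor_SomeD:
  assumes "find_reductor s k Gprev G (Some j)"
  shows "j \<in> G" and "sig_mult (HM (Poly s k) - HM (Poly s j)) (Sig s j) \<noteq> Sig s k"
proof -
  obtain js where js: "set js = G" and find: "Some j = find (\<lambda>j. mdvd (HM (Poly s j)) (HM (Poly s k)) \<and>
      (let u = HM (Poly s k) - HM (Poly s j)
       in sig_mult u (Sig s j) \<noteq> Sig s k \<and> \<not> is_rewritable s u j \<and>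
          \<not> top_reducible_by s Gprev (u + fst (Sig s j)))) js"
    using assms unfolding find_reductor_def by blast
  from find[symmetric, unfolded find_Some_iff] js
  show "j \<in> G" and "sig_mult (HM (Poly s k) - HM (Poly s j)) (Sig s j) \<noteq> Sig s k"
    unfolding Let_def by (metis nth_mem)+
qed

lemma has_sig_top_reduct:
  assumes "has_sig S f \<tau> (p - Poly_Mapping.single (HM p - HM q) (HC p / HC q) * q)"
  shows "has_sig S f \<tau> (top_reduct p q)"
proof (cases "p - Poly_Mapping.single (HM p - HM q) (HC p / HC q) * q = 0")
  case True
  then show ?thesis using assms by (simp add: top_reduct_def)
next
  case False
  then show ?thesis using has_sig_monic[OF assms] by (simp add: top_reduct_def)
qed

text \<open>The three fates of a to-do element: it is changed and stays, it is completed, or it has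
  become 0 and is dropped.\<close>

lemma accounted_update:
  assumes "accounted s G T" and "valid s" and "num s' = num s"
    and "k \<in> T" and "\<And>j. j \<in> {1..num s} \<Longrightarrow> j \<noteq> k \<Longrightarrow> Poly s' j = Poly s j"
  shows "accounted s' G T"
    and "Poly s' k \<noteq> 0 \<Longrightarrow> accounted s' (insert k G) (T - {k})"
    and "Poly s' k = 0 \<Longrightarrow> accounted s' G (T - {k})"
proof -
  have kG: "k \<notin> G" and G: "G \<subseteq> {1..num s}" and k: "k \<in> {i<..num s}"
    using assms(1,4) unfolding accounted_def by blast+
  have G0: "Poly s' j \<noteq> 0" if "j \<in> G" for j
  proof -
    have "j \<in> {1..num s}" "j \<noteq> k" using that G kG by blast+
    then show ?thesis using assms(1,5) that by (simp add: accounted_def)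
  qed
  have rest: "j \<in> G \<or> j \<in> T - {k} \<or> j = k \<or> Poly s' j = 0" if "j \<in> {i..num s}" for j
  proof -
    have "j \<in> {1..num s}" using that i_pos by simp
    then show ?thesis using assms(1,5) that unfolding accounted_def by (metis DiffI singletonD)
  qed
  show "accounted s' G T"
    using assms(1,3,4) G0 rest unfolding accounted_def by (metis DiffD1)
  show "accounted s' (insert k G) (T - {k})" if "Poly s' k \<noteq> 0"
    unfolding accounted_def
  proof (intro conjI ballI)
    show "insert k G \<subseteq> {1..num s'}" using G k assms(3) by auto
  qed (use assms(1,3) G0 rest that in \<open>auto simp: accounted_def\<close>)
  show "accounted s' G (T - {k})" if "Poly s' k = 0"
    unfolding accounted_def
  proof (intro conjI ballI)
    show "j \<in> G \<or> j \<in> T - {k} \<or> Poly s' j = 0" if "j \<in> {i..num s'}" for j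
      using rest[of j] that \<open>Poly s' k = 0\<close> assms(3) by auto
  qed (use assms(1,3) G0 in \<open>auto simp: accounted_def\<close>)
qed

lemma top_reduction_correct:
  assumes red: "top_reduction s k Gprev G s1 N D" and "valid s" and acc: "accounted s G T"
    and k: "k \<in> T"
  shows "valid s1 \<and> extends G s s1 \<and> accounted s1 (G \<union> N) (T - {k} \<union> D) \<and> N \<subseteq> {k}"
proof -
  have kn: "k \<in> {i<..num s}" "k \<notin> G" and G: "G \<subseteq> {1..num s}"
    using acc k by (auto simp: accounted_def)
  then have k1: "k \<in> {1..num s}" "k \<in> {i..num s}" using i_pos by auto
  have snd_k: "snd (Sig s k) = i" by (rule validD(7)[OF assms(2) k1(2)])
  have sig_k: "has_sig S f (fst (Sig s k)) (Poly s k)" by (rule validD(8)[OF assms(2) k1(2)])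
  have Poly_upd: "Poly (set_Poly k p s) j = (if j = k then p else Poly s j)"
    if "j \<in> {1..num s}" for p j
    using that k1(1) by (simp add: Poly_set_Poly)
  note upd = accounted_update[OF acc assms(2) num_set_Poly k]
  have ext_upd: "extends G s (set_Poly k p s)" for p
    by (rule extends_set_Poly[OF G k1(1) kn(2)])
  from red show ?thesis
  proof cases
    case zero
    then show ?thesis
      using assms(2) extends_refl[OF G] accounted_update(3)[OF acc assms(2) refl k] by simp
  next
    case irreducible
    have "valid s1"
      unfolding irreducible by (rule valid_set_Poly[OF assms(2) kn(1) has_sig_monic[OF sig_k]])
    moreover have "accounted s1 (insert k G) (T - {k})"
      unfolding irreducible by (rule upd(2)) (use irreducible Poly_upd k1(1) in auto)
    ultimately show ?thesis
      using ext_upd irreducible by simp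
  next
    case (safe j u)
    have j: "j \<in> G" by (rule find_reductor_SomeD(1)[OF safe(5)])
    then have j1: "j \<in> {1..num s}" and j0: "Poly s j \<noteq> 0"
      using G acc by (auto simp: accounted_def)
    \<comment> \<open>\<open>Poly_Mapping.single 0 1\<close> is the polynomial 1; it casts the
      reduction in the form of \<open>has_sig_combine\<close>.\<close>
    have "has_sig S f (0 + fst (Sig s k)) (Poly_Mapping.single 0 1 * Poly s k -
        Poly_Mapping.single u (HC (Poly s k) / HC (Poly s j)) * Poly s j)"
      by (rule has_sig_combine(1)[OF assms(2) k1(1) j1 _ _ snd_k])
         (use safe j0 in \<open>auto simp: sig_mult_def\<close>)
    then have "has_sig S f (fst (Sig s k)) (top_reduct (Poly s k) (Poly s j))"
      using safe(6) by (intro has_sig_top_reduct) simp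
    then have "valid s1"
      unfolding safe(1) by (rule valid_set_Poly[OF assms(2) kn(1)])
    moreover have "accounted s1 G T"
      unfolding safe(1) by (rule upd(1)) (use Poly_upd in auto)
    moreover have "T - {k} \<union> {k} = T" using k by auto
    ultimately show ?thesis
      using ext_upd safe(1-3) by simp
  next
    case (unsafe j u s2)
    have j: "j \<in> G" and neq: "sig_mult u (Sig s j) \<noteq> Sig s k"
      using find_reductor_SomeD[OF unsafe(5)] unsafe(6) by simp_all
    then have j1: "j \<in> {1..num s}" and j0: "Poly s j \<noteq> 0"
      using G acc by (auto simp: accounted_def)
    \<comment> \<open>The reductor search rules out equal signatures, so not smaller means larger.
      As \<open>i\<close> is the largest signature index, the reductor is then a new
      element.\<close>
    have snd_j: "snd (Sig s j) = i" and less: "sig_mult 0 (Sig s k) \<prec>\<^sub>S sig_mult u (Sig s j)"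
      using unsafe(7) neq snd_k new_iff(2)[OF assms(2) j1]
        less_cases[of "u + fst (Sig s j)" "fst (Sig s k)"]
      by (auto simp: sig_less_def sig_mult_def prod_eq_iff)
    have "has_sig S f (u + fst (Sig s j)) (Poly_Mapping.single 0 1 * Poly s k -
        Poly_Mapping.single u (HC (Poly s k) / HC (Poly s j)) * Poly s j)"
      by (rule has_sig_combine(2)[OF assms(2) j1 k1(1) _ _ snd_j less])
         (use unsafe j0 in auto)
    then have sig: "has_sig S f (u + fst (Sig s j)) (top_reduct (Poly s k) (Poly s j))"
      using unsafe(6) by (intro has_sig_top_reduct) simp
    have s1: "s1 = add_labeled (u + fst (Sig s j), i) (top_reduct (Poly s k) (Poly s j)) s"
      unfolding unsafe(1) unsafe(8) by (simp add: add_labeled_def sig_mult_def snd_j)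
    have "valid s1"
      unfolding s1 by (rule valid_add_labeled[OF assms(2) sig])
    moreover have "extends G s s1"
      unfolding s1 by (rule extends_add_labeled[OF G])
    moreover have "accounted s1 G (insert (Suc (num s)) T)"
      using acc i_pos validD(1)[OF assms(2)] unfolding s1
      by (auto simp: accounted_def Poly_add_labeled subset_iff le_Suc_eq)
    moreover have "T - {k} \<union> {k, Suc (num s)} = insert (Suc (num s)) T" using k by auto
    ultimately show ?thesis
      using unsafe(2,3,8) by simp
  qed
qed

lemma reduction_loop_correct:
  assumes "reduction_loop B Gprev Gcurr s todo completed s' R"
    and "valid s" and "accounted s (Gcurr \<union> completed) todo" and "Gcurr \<inter> completed = {}"
  shows "valid s' \<and> extends Gcurr s s' \<and> accounted s' (Gcurr \<union> R) {} \<and> Gcurr \<inter> R = {}"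
  using assms
proof (induction rule: reduction_loop.induct)
  case (finish s completed)
  then show ?case by (auto simp: accounted_def intro!: extends_refl)
next
  case (step k todo s q completed s1 N D s' R)
  let ?G = "Gcurr \<union> completed"
  have k: "k \<in> {i<..num s}" "k \<notin> ?G" and G: "?G \<subseteq> {1..num s}"
    using step.prems(2) step.hyps(1) unfolding accounted_def by blast+
  have "k \<in> {i..num s}" using k(1) by simp
  \<comment> \<open>The normal form modulo \<open>B\<close> differs from the polynomial by an
    element of the old ideal, so the same cofactor of \<open>f\<close> works for both.\<close>
  from validD(8)[OF step.prems(1) this]
  have "has_sig S f (fst (Sig s k)) q"
    by (rule has_sig_mod_ideal) (rule normal_form_mod_ideal[OF step.hyps(3) B])
  then have valid: "valid (set_Poly k q s)"
    by (rule valid_set_Poly[OF step.prems(1) k(1)])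
  have k1: "k \<in> {1..num s}" using k(1) i_pos by auto
  have acc: "accounted (set_Poly k q s) ?G todo"
    by (rule accounted_update(1)[OF step.prems(2,1) num_set_Poly step.hyps(1)])
       (use k1 in \<open>simp add: Poly_set_Poly\<close>)
  have ext: "extends ?G s (set_Poly k q s)"
    by (rule extends_set_Poly[OF G k1 k(2)])
  have *: "valid s1" "extends ?G (set_Poly k q s) s1" "accounted s1 (?G \<union> N) (todo - {k} \<union> D)"
    "N \<subseteq> {k}"
    using top_reduction_correct[OF step.hyps(4) valid acc step.hyps(1)] by blast+
  have "Gcurr \<union> (completed \<union> N) = ?G \<union> N" "Gcurr \<inter> (completed \<union> N) = {}"
    using *(4) k(2) step.prems(3) by auto
  then have IH: "valid s'" "extends Gcurr s1 s'" "accounted s' (Gcurr \<union> R) {}" "Gcurr \<inter> R = {}"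
    using step.IH[OF *(1)] *(3) by auto
  have "extends Gcurr s s1"
    using extends_trans[OF ext *(2)] by (rule extends_subset) simp
  then show ?case
    using IH extends_trans by blast
qed

section \<open>Pair bookkeeping along the loop of a pass\<close>

text \<open>Each fresh element is paired with everything collected so far. A pair that
  \<open>critical_pair\<close> suppresses meets the syzygy criterion, hence is \<open>dead\<close>
  at once.\<close>

lemma add_pairs_correct:
  assumes "add_pairs s i Gprev ks P G = (P', G')" and "valid s"
    and "distinct ks" and "set ks \<inter> G = {}" and "set ks \<subseteq> {i..num s}" and "G \<subseteq> {1..num s}"
    and "\<And>c. c \<in> P \<Longrightarrow> wf_pair s G c" and "covered s P G"
  shows "G' = G \<union> set ks \<and> (\<forall>c\<in>P'. wf_pair s G' c) \<and> covered s P' G'"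
  using assms
proof (induction ks arbitrary: P G)
  case Nil
  then show ?case by simp
next
  case (Cons k ks)
  define P2 where "P2 = P \<union> (\<Union>j\<in>G. critical_pair s k j i Gprev)"
  have k: "k \<notin> G" "k \<in> {1..num s}" "k \<in> {i..num s}" using Cons.prems i_pos by auto
  have snd_k: "snd (Sig s k) = i" by (rule validD(7)[OF Cons.prems(2) k(3)])
  have wf: "wf_pair s (G \<union> {k}) c" if "c \<in> critical_pair s k j i Gprev" "j \<in> G" for c j
  proof -
    have j: "j \<in> {1..num s}" "j \<noteq> k" using that(2) Cons.prems(6) k(1) by auto
    have nsyz: "\<not> syzygy s k j" "\<not> syzygy s j k"
      using that(1) by (auto simp: critical_pair_eq split: if_splits)
    show ?thesis
    proof (cases "sig_mult (cofactor s k j) (Sig s k) \<prec>\<^sub>S sig_mult (cofactor s j k) (Sig s j)")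
      case True
      \<comment> \<open>\<open>k\<close> has the maximal signature index, so a partner of larger
        signature shares it and is new as well.\<close>
      then have "snd (Sig s j) = i"
        using snd_k new_iff(2)[OF Cons.prems(2) j(1)] by (auto simp: sig_less_def sig_mult_def)
      moreover have "\<not> sig_mult (cofactor s j k) (Sig s j) \<prec>\<^sub>S sig_mult (cofactor s k j) (Sig s k)"
        using True less_trans[of "fst (sig_mult (cofactor s j k) (Sig s j))"
            "fst (sig_mult (cofactor s k j) (Sig s k))" "fst (sig_mult (cofactor s j k) (Sig s j))"]
        by (auto simp: sig_less_def)
      moreover have "c = pair s j k"
        using that(1) nsyz True by (simp add: critical_pair_eq)
      ultimately show ?thesis
        using that(2) j(2) unfolding wf_pair_def by blast
    next
      case False
      then have "c = pair s k j"
        using that(1) nsyz by (simp add: critical_pair_eq)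
      then show ?thesis
        using that(2) False snd_k j(2) unfolding wf_pair_def by blast
    qed
  qed
  have cov: "dead s k j \<or> pair s k j \<in> P2 \<or> pair s j k \<in> P2" if "j \<in> G" for j
  proof -
    have "dead s k j \<or> pair s k j \<in> critical_pair s k j i Gprev \<or>
        pair s j k \<in> critical_pair s k j i Gprev"
      by (simp add: critical_pair_eq dead_def)
    then show ?thesis using that unfolding P2_def by blast
  qed
  have "covered s P2 (G \<union> {k})"
    unfolding covered_def
  proof (intro ballI impI)
    fix a b
    assume ab: "a \<in> G \<union> {k}" "b \<in> G \<union> {k}" "a \<noteq> b" "i \<le> a"
    then consider "a \<in> G" "b \<in> G" | "a = k" "b \<in> G" | "a \<in> G" "b = k" by blast
    then show "dead s a b \<or> pair s a b \<in> P2 \<or> pair s b a \<in> P2"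
    proof cases
      case 1
      then have "dead s a b \<or> pair s a b \<in> P \<or> pair s b a \<in> P"
        using Cons.prems(8) ab unfolding covered_def by blast
      then show ?thesis unfolding P2_def by blast
    next
      case 2
      then show ?thesis using cov[of b] by simp
    next
      case 3
      then show ?thesis using cov[of a] dead_commute[of s a k] by auto
    qed
  qed
  moreover have "wf_pair s (G \<union> {k}) c" if c: "c \<in> P2" for c
  proof (cases "c \<in> P")
    case True
    then show ?thesis using wf_pair_mono[OF Cons.prems(7)] by blast
  next
    case False
    then obtain j where "j \<in> G" "c \<in> critical_pair s k j i Gprev"
      using c unfolding P2_def by blast
    then show ?thesis using wf by blast
  qed
  moreover have "add_pairs s i Gprev ks P2 (G \<union> {k}) = (P', G')"
    using Cons.prems(1) by (simp add: P2_def)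
  moreover have "set ks \<inter> (G \<union> {k}) = {}" "set ks \<subseteq> {i..num s}" "G \<union> {k} \<subseteq> {1..num s}"
    using Cons.prems(3-6) k by auto
  ultimately have "G' = (G \<union> {k}) \<union> set ks \<and> (\<forall>c\<in>P'. wf_pair s G' c) \<and> covered s P' G'"
    using Cons.IH[of P2 "G \<union> {k}"] Cons.prems(2,3) by (metis distinct.simps(2))
  then show ?case by auto
qed

text \<open>At the head of the loop nothing is under reduction, and each relevant pair is dead or
  waits in \<open>P\<close>; with \<open>P\<close> empty all of them are dead.\<close>

lemma incremental_loop_correct:
  assumes "incremental_loop i B Gprev s P G s' G'"
    and "valid s" and "accounted s G {}" and "\<And>c. c \<in> P \<Longrightarrow> wf_pair s G c" and "covered s P G"
  shows "valid s' \<and> accounted s' G' {} \<and> covered s' {} G'"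
  using assms
proof (induction rule: incremental_loop.induct)
  case (finish s G)
  then show ?case by simp
next
  case (step P d Pd s s1 T G s2 R ks P' G1 s' G')
  have G: "G \<subseteq> {1..num s}" and G0: "\<And>k. k \<in> G \<Longrightarrow> Poly s k \<noteq> 0" and prev: "Gprev \<subseteq> G"
    using step.prems(2) by (auto simp: accounted_def Gprev)
  have Pd: "Pd \<subseteq> P" using step.hyps(3) by auto
  obtain ps T0 where ps: "set ps = Pd" and run: "compute_spols_list ps s [] = (s1, T0)"
    and T: "mset T = mset T0"
    using step.hyps(4) unfolding compute_spols_def by blast
  have spols: "valid s1" "extends {1..num s} s s1"
    "set T = {j \<in> {num s<..num s1}. Poly s1 j \<noteq> 0}"
    "\<And>k l. pair s k l \<in> Pd \<Longrightarrow>
       is_rewritable s1 (cofactor s k l) k \<or> is_rewritable s1 (cofactor s l k) l"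
  proof -
    have wf: "wf_pair s G c" if "c \<in> set ps" for c
      using step.prems(3) that Pd ps by blast
    show "valid s1" "extends {1..num s} s s1"
      "set T = {j \<in> {num s<..num s1}. Poly s1 j \<noteq> 0}"
      "\<And>k l. pair s k l \<in> Pd \<Longrightarrow>
         is_rewritable s1 (cofactor s k l) k \<or> is_rewritable s1 (cofactor s l k) l"
      using compute_spols_list_correct[OF run step.prems(1) G G0 wf] ps mset_eq_setD[OF T]
      by simp_all
  qed
  have ext1: "extends G s s1" by (rule extends_subset[OF spols(2) G])
  \<comment> \<open>\<open>G \<union> {}\<close> has the shape
    \<open>Gcurr \<union> completed\<close> with which the reduction loop starts.\<close>
  have acc1: "accounted s1 (G \<union> {}) (set T)"
  proof -
    have le: "i \<le> num s" "num s \<le> num s1" and same: "\<And>j. j \<in> {1..num s} \<Longrightarrow> Poly s1 j = Poly s j"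
      using validD(1)[OF step.prems(1)] spols(2) by (auto simp: extends_def)
    have old: "j \<in> G \<or> Poly s1 j = 0" if "j \<in> {i..num s}" for j
      using step.prems(2) that same[of j] i_pos by (auto simp: accounted_def)
    have "j \<in> G \<or> j \<in> set T \<or> Poly s1 j = 0" if "j \<in> {i..num s1}" for j
      using that old[of j] spols(3) by (cases "j \<le> num s") auto
    moreover have "{1..i} \<subseteq> G" using step.prems(2) by (simp add: accounted_def)
    moreover have "G \<subseteq> {1..num s1}" using G le by auto
    moreover have "set T \<subseteq> {i<..num s1}" "G \<inter> set T = {}"
      using spols(3) le G by auto
    moreover have "\<forall>j\<in>G. Poly s1 j \<noteq> 0" using same G G0 by auto
    ultimately show ?thesis by (simp add: accounted_def)
  qed
  have red: "valid s2" "extends G s1 s2" "accounted s2 (G \<union> R) {}" "G \<inter> R = {}"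
    using reduction_loop_correct[OF step.hyps(5)[unfolded reduction_def] spols(1) acc1] by blast+
  have ext2: "extends G s s2" by (rule extends_trans[OF ext1 red(2)])
  \<comment> \<open>A pair taken out of \<open>P\<close> died while the S-polynomials were computed,
    and the reduction keeps it dead.\<close>
  have "dead s2 k l" if kl: "k \<in> G" "l \<in> G" "pair s k l \<in> P - (P - Pd)" for k l
  proof -
    have "is_rewritable s1 (cofactor s1 k l) k \<or> is_rewritable s1 (cofactor s1 l k) l"
      using spols(4)[of k l] kl extends_pair[OF ext1] by auto
    then have "dead s1 k l" by (auto simp: dead_def)
    then show ?thesis by (rule dead_extends[OF red(2) prev kl(1,2)])
  qed
  then have cov: "covered s2 (P - Pd) G"
    using covered_extends[OF ext2 prev step.prems(4)] by blast
  have R: "set ks \<subseteq> {i..num s2}" "set ks \<inter> G = {}" "G \<subseteq> {1..num s2}"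
  proof -
    have GR: "G \<union> R \<subseteq> {1..num s2}" using red(3) by (simp add: accounted_def)
    moreover have "{1..i} \<subseteq> G" using step.prems(2) by (simp add: accounted_def)
    then have "j \<notin> {1..i}" if "j \<in> R" for j using that red(4) by blast
    ultimately have "R \<subseteq> {i..num s2}" by fastforce
    then show "set ks \<subseteq> {i..num s2}" "set ks \<inter> G = {}" "G \<subseteq> {1..num s2}"
      using GR red(4) step.hyps(7) by auto
  qed
  have wf: "wf_pair s2 G c" if "c \<in> P - Pd" for c
    using that step.prems(3) wf_pair_extends[OF ext2] by blast
  have "G1 = G \<union> set ks \<and> (\<forall>c\<in>P'. wf_pair s2 G1 c) \<and> covered s2 P' G1"
    by (rule add_pairs_correct[OF step.hyps(8) red(1) step.hyps(6) R(2,1,3) wf cov])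
  then have G1: "covered s2 P' G1" "accounted s2 G1 {}" "\<And>c. c \<in> P' \<Longrightarrow> wf_pair s2 G1 c"
    using red(3) step.hyps(7) by blast+
  show ?case
    by (rule step.IH[OF red(1) G1(2,3,1)])
qed

section \<open>The Groebner property at termination\<close>

text \<open>The lcm of the pair divides the head monomial of the multiple of \<open>k\<close> by
  \<open>u\<close>, so the cofactor of \<open>k\<close> divides \<open>u\<close>. Both criteria fail
  for \<open>u\<close> and hence for this divisor.\<close>

lemma not_dead_new:
  assumes "valid s" and "k \<in> {i..num s}" and "\<not> is_rewritable s u k"
    and "\<not> top_reducible_by s Gprev (u + fst (Sig s k))"
    and "mdvd (HM (Poly s l)) (u + HM (Poly s k))"
  shows "\<not> syzygy s k l" and "\<not> is_rewritable s (cofactor s k l) k"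
    and "mdvd (mlcm (HM (Poly s k)) (HM (Poly s l))) (u + HM (Poly s k))"
proof -
  show dvd: "mdvd (mlcm (HM (Poly s k)) (HM (Poly s l))) (u + HM (Poly s k))"
    by (rule mlcm_least[OF mdvd_add(2) assms(5)])
  have "cofactor s k l + HM (Poly s k) = mlcm (HM (Poly s k)) (HM (Poly s l))"
    by (simp add: cofactor_def)
  then have cof: "mdvd (cofactor s k l) u"
    using dvd mdvd_add_cancel(1)[of "cofactor s k l" "HM (Poly s k)" u] by simp
  then show "\<not> is_rewritable s (cofactor s k l) k"
    by (rule nonrewritable_mdvd[OF assms(1-3)])
  have "mdvd (cofactor s k l + fst (Sig s k)) (u + fst (Sig s k))"
    using cof by simp
  then show "\<not> syzygy s k l"
    using assms(4) mdvd_trans unfolding syzygy_def top_reducible_by_def by blast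
qed

lemma groebner_basis_final:
  assumes valid: "valid s" and acc: "accounted s G {}" and cov: "covered s {} G"
  shows "groebner_basis (Poly s ` G) (ideal_gen (insert f S))"
proof -
  let ?sg = "\<lambda>k. fst (Sig s k)" and ?Gp = "Poly s0 ` Gprev"
  \<comment> \<open>\<open>?N\<close> includes the elements reduced to 0: the element chosen at a
    signature may be one of them.\<close>
  let ?N = "{i..num s}"
  let ?canon = "\<lambda>k \<tau>. mdvd (?sg k) \<tau> \<and> \<not> is_rewritable s (\<tau> - ?sg k) k"
  have red_iff: "(\<exists>g\<in>?Gp. mdvd (HM g) t) \<longleftrightarrow> top_reducible_by s Gprev t" for t
    using validD(5)[OF valid] by (auto simp: top_reducible_by_def)
  have prev_G: "Gprev \<subseteq> G" and i_G: "i \<in> G" and G: "G \<subseteq> {1..num s}"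
    and G0: "\<And>j. j \<in> G \<Longrightarrow> Poly s j \<noteq> 0"
    using acc i_pos by (auto simp: accounted_def Gprev)
  have N_G: "k \<in> G" if "k \<in> ?N" "Poly s k \<noteq> 0" for k
    using acc that by (auto simp: accounted_def)
  have dead: "dead s k l" if "k \<in> ?N" "Poly s k \<noteq> 0" "l \<in> G" "k \<noteq> l" for k l
  proof -
    have "k \<in> G" "i \<le> k" using that N_G by auto
    then show ?thesis using cov that(3,4) unfolding covered_def by blast
  qed
  have Gp_ideal: "ideal_gen ?Gp = ideal_gen S"
    using basis by (simp add: groebner_basis_def)
  have Gp: "?Gp \<subseteq> ideal_gen S"
    using ideal_gen_base[of _ ?Gp] by (simp add: Gp_ideal subset_iff)
  have irred_Gp: "\<not> top_reducible_by s Gprev (\<tau> - ?sg k + HM (Poly s k))"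
    if k: "k \<in> ?N" "?canon k \<tau>" "\<not> top_reducible_by s Gprev \<tau>" "Poly s k \<noteq> 0" for k \<tau>
  proof
    let ?u = "\<tau> - ?sg k"
    let ?Q = "\<lambda>l. l \<in> Gprev \<and> mdvd (HM (Poly s l)) (?u + HM (Poly s k))"
    assume "top_reducible_by s Gprev (?u + HM (Poly s k))"
    then have "\<exists>l. ?Q l" unfolding top_reducible_by_def by blast
    \<comment> \<open>The phantom rules make \<open>l\<close> rewritable only by a smaller old index, so the least \<open>l\<close> is not.\<close>
    then obtain l where l: "?Q l" "\<And>j. j < l \<Longrightarrow> \<not> ?Q j"
      unfolding exists_least_iff[of ?Q] by blast
    have u: "\<not> is_rewritable s ?u k" "\<not> top_reducible_by s Gprev (?u + ?sg k)"
      using k(2,3) by simp_all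
    note nd = not_dead_new[OF valid k(1) u, of l]
    have "Sig s l = (0, l)" "l < i"
      using validD(4)[OF valid, of l] l(1) by (auto simp: Gprev)
    \<comment> \<open>The syzygy criterion concerns new elements only, and \<open>k\<close> meets
      neither criterion, so the pair can be dead only because \<open>l\<close> is
      rewritable.\<close>
    then have "\<not> syzygy s l k" by (simp add: syzygy_def)
    moreover have "dead s k l"
      using dead[OF k(1,4)] l(1) prev_G k(1) \<open>l < i\<close> by auto
    ultimately have "is_rewritable s (cofactor s l k) l"
      using nd l(1) by (auto simp: dead_def)
    then obtain j where j: "j \<in> Gprev" "j < l"
      "mdvd (HM (Poly s j)) (cofactor s l k + HM (Poly s l))"
      using prev_rewritable[OF valid] l(1) by blast
    have "cofactor s l k + HM (Poly s l) = mlcm (HM (Poly s k)) (HM (Poly s l))"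
      by (simp add: cofactor_def mlcm_commute[of "HM (Poly s l)"])
    then have "mdvd (HM (Poly s j)) (?u + HM (Poly s k))"
      using j(3) nd(3) l(1) mdvd_trans by simp
    then show False
      using l(2)[OF j(2)] j(1) by simp
  qed
  have irred: "\<not> (\<exists>l\<in>?N. \<exists>v. Poly s l \<noteq> 0 \<and> ?canon l (v + ?sg l) \<and>
      \<not> top_reducible_by s Gprev (v + ?sg l) \<and> (v + ?sg l \<prec>\<^sub>T \<sigma> \<or> v + ?sg l = \<sigma>) \<and>
      v + HM (Poly s l) = \<tau> - ?sg k + HM (Poly s k))"
    if k: "k \<in> ?N" "?canon k \<tau>" "\<not> top_reducible_by s Gprev \<tau>" "Poly s k \<noteq> 0" "\<sigma> \<prec>\<^sub>T \<tau>" for k \<tau> \<sigma>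
  proof
    let ?u = "\<tau> - ?sg k"
    assume "\<exists>l\<in>?N. \<exists>v. Poly s l \<noteq> 0 \<and> ?canon l (v + ?sg l) \<and>
      \<not> top_reducible_by s Gprev (v + ?sg l) \<and> (v + ?sg l \<prec>\<^sub>T \<sigma> \<or> v + ?sg l = \<sigma>) \<and>
      v + HM (Poly s l) = \<tau> - ?sg k + HM (Poly s k)"
    then obtain l v where l: "l \<in> ?N" "Poly s l \<noteq> 0" "\<not> is_rewritable s v l"
      "\<not> top_reducible_by s Gprev (v + ?sg l)" "v + ?sg l \<prec>\<^sub>T \<sigma> \<or> v + ?sg l = \<sigma>"
      "v + HM (Poly s l) = ?u + HM (Poly s k)"
      by auto
    have u: "\<not> is_rewritable s ?u k" "\<not> top_reducible_by s Gprev (?u + ?sg k)"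
      using k(2,3) by simp_all
    have "v + ?sg l \<prec>\<^sub>T \<tau>" using l(5) k(5) less_trans by blast
    \<comment> \<open>With \<open>k = l\<close> the equal head monomials would force
      \<open>v = ?u\<close>, hence equal signatures.\<close>
    then have "k \<noteq> l" using l(6) k(2) by auto
    \<comment> \<open>The common head monomial is divisible by those of both elements, so
      \<open>not_dead_new\<close> applies in both directions.\<close>
    have "mdvd (HM (Poly s l)) (?u + HM (Poly s k))"
      unfolding l(6)[symmetric] by (rule mdvd_add(2))
    moreover have "mdvd (HM (Poly s k)) (v + HM (Poly s l))"
      unfolding l(6) by (rule mdvd_add(2))
    ultimately have "\<not> dead s k l"
      using not_dead_new[OF valid k(1) u, of l] not_dead_new[OF valid l(1,3,4), of k]
      by (simp add: dead_def)
    then show False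
      using dead[OF k(1,4) N_G[OF l(1,2)] \<open>k \<noteq> l\<close>] by simp
  qed
  have covers: "top_reducible_by s Gprev (HM p) \<or> (\<exists>l\<in>?N. \<exists>v. Poly s l \<noteq> 0 \<and>
      ?canon l (v + ?sg l) \<and> \<not> top_reducible_by s Gprev (v + ?sg l) \<and>
      (v + ?sg l \<prec>\<^sub>T \<tau> \<or> v + ?sg l = \<tau>) \<and> v + HM (Poly s l) = HM p)"
    if "has_sig S f \<tau> p" "p \<noteq> 0" for \<tau> p
  \<comment> \<open>\<open>red_iff\<close> turns divisibility by the old basis as stored in
    \<open>s0\<close> into \<open>top_reducible_by\<close> in the final state.\<close>
  proof (rule rewrite_basis_covers[where N = ?N and sg = ?sg and P = "Poly s" and Gp = ?Gp
        and canon = ?canon and S = S and f = f, unfolded red_iff])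
    show "0 \<notin> ?Gp" using prev_nonzero by auto
    show "top_reducible_by s Gprev (HM q)" if "q \<in> ideal_gen S" "q \<noteq> 0" for q
      unfolding red_iff[symmetric] using basis that unfolding groebner_basis_def by blast
    show "has_sig S f (?sg k) (Poly s k)" if "k \<in> ?N" for k
      by (rule validD(8)[OF valid that])
    show "\<exists>k\<in>?N. ?canon k \<tau>" for \<tau> by (rule ex_nonrewritable[OF valid])
  qed (rule Gp, blast, erule (4) irred, erule (3) irred_Gp, rule that, rule that)
  have mem_iff: "p \<in> ideal_gen (insert f S) \<longleftrightarrow> (\<exists>h. p - h * f \<in> ideal_gen S)" for p
    by (simp add: ideal_gen_insert)
  have "p \<in> ideal_gen (insert f S)" if "p \<in> ideal_gen S" for p
    unfolding mem_iff using that by (intro exI[of _ 0]) simp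
  then have "Poly s j \<in> ideal_gen (insert f S)" if "j \<in> G" for j
    using prev_or_new[of j s] prev_in_ideal[OF valid, of j] validD(8)[OF valid, of j] G that
    unfolding has_sig_def mem_iff by blast
  moreover have "f \<in> ideal_gen (Poly s ` G)"
    using validD(3)[OF valid] i_G by (intro ideal_gen_base) auto
  moreover have "?Gp = Poly s ` Gprev"
    by (rule image_cong) (simp_all add: validD(5)[OF valid])
  then have "?Gp \<subseteq> ideal_gen (Poly s ` G)"
    using prev_G ideal_gen_base by blast
  then have "ideal_gen S \<subseteq> ideal_gen (Poly s ` G)"
    unfolding Gp_ideal[symmetric] by (rule ideal_gen_subsetI)
  then have "S \<subseteq> ideal_gen (Poly s ` G)"
    using ideal_gen_base by blast
  ultimately have ideal: "ideal_gen (Poly s ` G) = ideal_gen (insert f S)"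
    by (intro ideal_gen_eqI) auto
  have "\<exists>g\<in>Poly s ` G. g \<noteq> 0 \<and> mdvd (HM g) (HM p)" if p: "p \<in> ideal_gen (insert f S)" "p \<noteq> 0" for p
  proof -
    obtain h where h: "p - h * f \<in> ideal_gen S" using p(1) mem_iff by blast
    have "top_reducible_by s Gprev (HM p) \<or> (\<exists>l\<in>?N. Poly s l \<noteq> 0 \<and> mdvd (HM (Poly s l)) (HM p))"
    \<comment> \<open>\<open>has_sig\<close> asks for a nonzero cofactor; for \<open>h = 0\<close>
      the polynomial lies in the old ideal, where the old basis suffices.\<close>
    proof (cases "h = 0")
      case True
      then show ?thesis
        using basis h p(2) unfolding groebner_basis_def red_iff[symmetric] by auto
    next
      case False
      then have "has_sig S f (HM h) p" using h unfolding has_sig_def by blast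
      from covers[OF this p(2)] show ?thesis using mdvd_add(2) by metis
    qed
    then show ?thesis
      using prev_G G0 N_G unfolding top_reducible_by_def by blast
  qed
  moreover have "finite (Poly s ` G)" using G finite_subset by blast
  ultimately show ?thesis
    using ideal by (simp add: groebner_basis_def)
qed

lemma incremental_basis_correct:
  assumes "incremental_loop i B Gprev s0 (\<Union>j\<in>Gprev. critical_pair s0 i j i Gprev)
      (Gprev \<union> {i}) s G"
  shows "groebner_basis (Poly s ` G) (ideal_gen (insert f S))"
proof -
  let ?P = "\<Union>j\<in>Gprev. critical_pair s0 i j i Gprev"
  \<comment> \<open>The initial pairs arise as if \<open>add_pairs\<close> added \<open>i\<close> to
    the old basis, so \<open>add_pairs_correct\<close> yields the invariant at the start.\<close>
  have pairs: "add_pairs s0 i Gprev [i] {} Gprev = (?P, Gprev \<union> {i})" by simp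
  have acc: "accounted s0 (Gprev \<union> {i}) {}"
    using prev_nonzero Poly_init f num_init i_pos by (auto simp: accounted_def Gprev)
  have "covered s0 {} Gprev" unfolding covered_def by (auto simp: Gprev)
  have "(\<forall>c\<in>?P. wf_pair s0 (Gprev \<union> {i}) c) \<and> covered s0 ?P (Gprev \<union> {i})"
  proof -
    have "distinct [i]" "set [i] \<inter> Gprev = {}" "set [i] \<subseteq> {i..num s0}" "Gprev \<subseteq> {1..num s0}"
      "\<And>c. c \<in> {} \<Longrightarrow> wf_pair s0 Gprev c"
      using num_init unfolding Gprev by auto
    from add_pairs_correct[OF pairs valid_init this \<open>covered s0 {} Gprev\<close>] show ?thesis
      by blast
  qed
  then have "valid s \<and> accounted s G {} \<and> covered s {} G"
    by (intro incremental_loop_correct[OF assms valid_init acc]) blast+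
  then show ?thesis
    using groebner_basis_final by blast
qed

end

section \<open>The main loop\<close>

context monomial_order
begin

definition reduced_setup :: "('x, 'a::field) state \<Rightarrow> bool" where
  "reduced_setup s \<longleftrightarrow> length (rules s) = num s \<and> (\<forall>j\<in>{1..num s}. Sig s j = (0, j)) \<and>
     (\<forall>l\<in>{1..num s}. \<forall>(\<sigma>, j')\<in>set (rules s ! (l - 1)).
        \<exists>j\<in>{1..<l}. \<sigma> + HM (Poly s l) = mlcm (HM (Poly s j)) (HM (Poly s l)))"

lemma setup_state_correct:
  shows "reduced_setup (setup_state Bs)" and "num (setup_state Bs) = length Bs"
    and "j \<in> {1..length Bs} \<Longrightarrow> Poly (setup_state Bs) j = Bs ! (j - 1)"
proof -
  let ?lab = "map (\<lambda>j. ((0 :: 'x mon, j), Bs ! (j - 1))) [1..<length Bs + 1]"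
  let ?I = "\<lambda>s. labeled s = ?lab \<and> length (rules s) = length Bs \<and>
    (\<forall>l\<in>{1..length Bs}. \<forall>(\<sigma>, j')\<in>set (rules s ! (l - 1)).
       \<exists>j\<in>{1..<l}. \<sigma> + HM (Bs ! (l - 1)) = mlcm (HM (Bs ! (j - 1))) (HM (Bs ! (l - 1))))"
  have I: "?I (setup_state Bs)"
    unfolding setup_state_def
  proof (rule fold_invariant[where Q = "\<lambda>(j, k). 1 \<le> j \<and> j < k" and P = ?I])
    show "\<And>x. x \<in> set [(j, k). k \<leftarrow> [1..<length Bs + 1], j \<leftarrow> [1..<k]] \<Longrightarrow>
        case x of (j, k) \<Rightarrow> 1 \<le> j \<and> j < k"
      by auto
    show "?I \<lparr>labeled = ?lab, rules = replicate (length Bs) []\<rparr>"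
      by auto
  next
    fix x :: "nat \<times> nat" and s :: "('x, 'a) state"
    obtain j k where x: "x = (j, k)" by (cases x)
    assume "case x of (j, k) \<Rightarrow> 1 \<le> j \<and> j < k" and s: "?I s"
    then have jk: "1 \<le> j" "j < k" by (simp_all add: x)
    define \<sigma> where "\<sigma> = mlcm (HM (Bs ! (j - 1))) (HM (Bs ! (k - 1))) - HM (Bs ! (k - 1))"
    have \<sigma>: "\<sigma> + HM (Bs ! (k - 1)) = mlcm (HM (Bs ! (j - 1))) (HM (Bs ! (k - 1)))"
      by (simp add: \<sigma>_def)
    let ?s = "add_rule (sig_mult \<sigma> (0, k)) 0 s"
    have rules: "rules ?s = (rules s)[k - 1 := rules s ! (k - 1) @ [(\<sigma>, 0)]]"
      by (simp add: add_rule_def sig_mult_def Let_def)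
    have "\<exists>j\<in>{1..<l}. \<sigma>' + HM (Bs ! (l - 1)) = mlcm (HM (Bs ! (j - 1))) (HM (Bs ! (l - 1)))"
      if l: "l \<in> {1..length Bs}" and mem: "(\<sigma>', j') \<in> set (rules ?s ! (l - 1))" for l \<sigma>' j'
    proof (cases "(\<sigma>', j') \<in> set (rules s ! (l - 1))")
      case True
      then show ?thesis using s l by fastforce
    next
      case False
      \<comment> \<open>An entry that was absent before can only be the appended rule; as
        \<open>l\<close> and \<open>k\<close> are positive, equal positions mean equal
        indices.\<close>
      then have "l - 1 = k - 1" "\<sigma>' = \<sigma>"
      proof -
        have "l - 1 < length (rules s)" using l s by auto
        then show "l - 1 = k - 1" "\<sigma>' = \<sigma>"
          using mem False by (cases "l - 1 = k - 1"; auto simp: rules)+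
      qed
      then have "l = k" using l jk by simp
      then show ?thesis
        using \<sigma> \<open>\<sigma>' = \<sigma>\<close> jk by (intro bexI[of _ j]) auto
    qed
    then have "?I ?s" using s by (auto simp: rules)
    then show "?I ((case x of (j, k) \<Rightarrow>
        let t = mlcm (HM (Bs ! (j - 1))) (HM (Bs ! (k - 1)))
        in add_rule (sig_mult (t - HM (Bs ! (k - 1))) (0, k)) 0) s)"
      by (simp add: x \<sigma>_def Let_def)
  qed
  then have lab: "labeled (setup_state Bs) = ?lab" by blast
  show num: "num (setup_state Bs) = length Bs"
    by (simp add: num_def lab del: upt_Suc)
  show Poly: "Poly (setup_state Bs) j = Bs ! (j - 1)" if "j \<in> {1..length Bs}" for j
    using that by (auto simp: Poly_def lab nth_append simp del: upt_Suc)
  have "Sig (setup_state Bs) j = (0, j)" if "j \<in> {1..length Bs}" for j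
    using that by (auto simp: Sig_def lab nth_append simp del: upt_Suc)
  then show "reduced_setup (setup_state Bs)"
    using I Poly unfolding reduced_setup_def num by (fastforce simp: Ball_def)
qed

text \<open>At the start \<open>B\<close> holds the first input itself while the state holds its
  monic form; hence the inclusion of \<open>B\<close> in the ideal in place of an equality with the
  stored basis.\<close>

definition loop_invariant ::
    "('x, 'a::field) mpoly set \<Rightarrow> ('x, 'a) state \<Rightarrow> nat set \<Rightarrow> ('x, 'a) mpoly set \<Rightarrow> bool" where
  "loop_invariant S s Gprev B \<longleftrightarrow> Gprev = {1..num s} \<and> reduced_setup s \<and>
     (\<forall>j\<in>Gprev. Poly s j \<noteq> 0) \<and> groebner_basis (Poly s ` Gprev) (ideal_gen S) \<and>
     B \<subseteq> ideal_gen S"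

lemma pass_correct:
  assumes inv: "loop_invariant S s Gprev B" and "f \<noteq> 0" and s1: "s1 = append_input f s"
    and run: "incremental_basis s1 (num s1) B Gprev s2 G"
  shows "groebner_basis (Poly s2 ` G) (ideal_gen (insert f S))"
proof -
  \<comment> \<open>The signature index of the new input is \<open>num s1\<close>, one more than the
    size of the old basis, and not the loop counter, since each setup renumbers the basis.\<close>
  define s0 where "s0 = s1\<lparr>rules := rules s1 @ [[]]\<rparr>"
  have num: "num s1 = Suc (num s)" "num s0 = Suc (num s)"
    by (simp_all add: s0_def s1 append_input_def num_def append_labeled_def)
  have Sig: "Sig s0 j = (if j = Suc (num s) then (0, Suc (num s)) else Sig s j)"
    and Poly: "Poly s0 j = (if j = Suc (num s) then monic f else Poly s j)"
    if "j \<in> {1..Suc (num s)}" for j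
    using that
    by (auto simp: s0_def s1 append_input_def num_def append_labeled_def Sig_def Poly_def nth_append)
  have rules: "rules s0 = rules s @ [[]]"
    by (simp add: s0_def s1 append_input_def append_labeled_def)
  have st: "length (rules s) = num s" "\<And>j. j \<in> {1..num s} \<Longrightarrow> Sig s j = (0, j)"
    "\<And>l \<sigma> j'. l \<in> {1..num s} \<Longrightarrow> (\<sigma>, j') \<in> set (rules s ! (l - 1)) \<Longrightarrow>
       \<exists>j\<in>{1..<l}. \<sigma> + HM (Poly s l) = mlcm (HM (Poly s j)) (HM (Poly s l))"
    and Gprev: "Gprev = {1..num s}"
    using inv unfolding loop_invariant_def reduced_setup_def by blast+
  have Poly_prev: "Poly s0 ` Gprev = Poly s ` Gprev"
    by (rule image_cong) (use Poly in \<open>auto simp: Gprev\<close>)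
  interpret f5c_pass less_mon "Suc (num s)" Gprev B S "monic f" s0
  proof
    show "Gprev = {1..<Suc (num s)}" by (auto simp: Gprev)
    show "B \<subseteq> ideal_gen S" "groebner_basis (Poly s0 ` Gprev) (ideal_gen S)"
      using inv unfolding loop_invariant_def Poly_prev by blast+
    show "Poly s0 j \<noteq> 0" if "j \<in> Gprev" for j
      using inv that Poly[of j] by (auto simp: loop_invariant_def Gprev)
    show "Sig s0 j = (0, j)" if "j \<in> {1..Suc (num s)}" for j
      using that Sig[OF that] st(2)[of j] by auto
    show "\<exists>j\<in>{1..<l}. \<sigma> + HM (Poly s0 l) = mlcm (HM (Poly s0 j)) (HM (Poly s0 l))"
      if l: "l \<in> Gprev" and mem: "(\<sigma>, j') \<in> set (rules s0 ! (l - 1))" for l \<sigma> j'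
    proof -
      have "(\<sigma>, j') \<in> set (rules s ! (l - 1))"
      proof -
        have "l - 1 < length (rules s)" using l st(1) by (auto simp: Gprev)
        then show ?thesis using mem by (simp add: rules nth_append)
      qed
      then obtain j where "j \<in> {1..<l}"
        "\<sigma> + HM (Poly s l) = mlcm (HM (Poly s j)) (HM (Poly s l))"
        using st(3) l Gprev by blast
      then show ?thesis
        using Poly[of j] Poly[of l] l by (intro bexI[of _ j]) (auto simp: Gprev)
    qed
  qed (use assms(2) num Poly[of "Suc (num s)"] st(1) in \<open>simp_all add: rules nth_append\<close>)
  have "incremental_loop (Suc (num s)) B Gprev s0
      (\<Union>j\<in>Gprev. critical_pair s0 (Suc (num s)) j (Suc (num s)) Gprev)
      (Gprev \<union> {Suc (num s)}) s2 G"
    using run by (simp add: incremental_basis_def Let_def num s0_def)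
  then have "groebner_basis (Poly s2 ` G) (ideal_gen (insert (monic f) S))"
    by (rule incremental_basis_correct)
  moreover have "ideal_gen (insert (monic f) S) = ideal_gen (insert f S)"
  proof (rule ideal_gen_eqI)
    have "f \<in> ideal_gen (insert (monic f) S)" "monic f \<in> ideal_gen (insert f S)"
      by (metis ideal_gen_base insertI1 monic_in_ideal_iff)+
    then show "insert (monic f) S \<subseteq> ideal_gen (insert f S)"
      "insert f S \<subseteq> ideal_gen (insert (monic f) S)"
      by (auto intro: ideal_gen_base)
  qed
  ultimately show ?thesis by simp
qed

lemma set_take_pred:
  assumes "2 \<le> i" and "i \<le> length F"
  shows "set (take i F) = insert (F ! (i - 1)) (set (take (i - 1) F))"
  using take_Suc_conv_app_nth[of "i - 1" F] assms by (simp add: Suc_diff_1)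

lemma f5c_loop_invariant:
  assumes "f5c_loop F i s Gprev B" and "F \<noteq> []" and "\<forall>f\<in>set F. f \<noteq> 0"
  shows "2 \<le> i \<and> loop_invariant (set (take (i - 1) F)) s Gprev B"
  using assms(1)
proof (induction rule: f5c_loop.induct)
  case start
  define s :: "('x, 'a) state" where
    "s = \<lparr>labeled = [((0, 1), monic (F ! 0))], rules = [[]]\<rparr>"
  have s: "num s = 1" "Sig s 1 = (0, 1)" "Poly s 1 = monic (F ! 0)" "rules s = [[]]"
    by (simp_all add: s_def num_def Sig_def Poly_def)
  have F0: "F ! 0 \<noteq> 0" "set (take 1 F) = {F ! 0}"
    using assms(2,3) by (cases F; simp)+
  have "groebner_basis (Poly s ` {1}) (ideal_gen {F ! 0})"
    using groebner_basis_monic[OF groebner_basis_singleton[OF F0(1)]] s(3) by simp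
  then have "loop_invariant {F ! 0} s {1} {F ! 0}"
    using s F0(1) by (auto simp: loop_invariant_def reduced_setup_def intro: ideal_gen_base)
  then show ?case
    using F0(2) by (simp add: s_def)
next
  case (pass i s Gprev B s1 s2 Gcurr s3 Gprev')
  have "F ! (i - 1) \<in> set F" using pass by (intro nth_mem) auto
  then have "F ! (i - 1) \<noteq> 0" using assms(3) by blast
  then have "groebner_basis (Poly s2 ` Gcurr) (ideal_gen (set (take i F)))"
    using pass_correct[of _ s Gprev B "F ! (i - 1)"] pass set_take_pred by metis
  moreover obtain Bs where "interreduction (Poly s2 ` Gcurr) (set Bs)" and s3: "s3 = setup_state Bs"
    and Gprev': "Gprev' = {1..length Bs}"
    using pass.hyps(6) unfolding setup_reduced_basis_def by blast
  ultimately have Bs: "groebner_basis (set Bs) (ideal_gen (set (take i F)))" "0 \<notin> set Bs"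
    using groebner_basis_interreduction by blast+
  have "Poly s3 ` Gprev' = (\<lambda>j. Bs ! (j - 1)) ` {1..length Bs}"
    unfolding s3 Gprev' by (rule image_cong) (simp_all add: setup_state_correct(3))
  also have "\<dots> = set Bs"
    \<comment> \<open>The index set \<open>{1..length Bs}\<close> is the image of
      \<open>{..<length Bs}\<close> under \<open>Suc\<close>, which undoes the shift by 1 in the
      list positions.\<close>
    unfolding One_nat_def image_Suc_lessThan[symmetric, unfolded One_nat_def] image_image
    by (auto simp: set_conv_nth)
  finally have Poly: "Poly s3 ` Gprev' = set Bs" .
  then have "set Bs \<subseteq> ideal_gen (set (take i F))"
    using Bs(1) ideal_gen_base[of _ "set Bs"] by (auto simp: groebner_basis_def)
  then have "loop_invariant (set (take i F)) s3 Gprev' (Poly s3 ` Gprev')"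
    using Bs Poly setup_state_correct(1,2)[of Bs] Gprev'
    unfolding loop_invariant_def s3 by (metis image_eqI)
  then show ?case using pass by simp
qed

end

theorem theorem29:
  fixes less_mon :: "('x::finite) mon \<Rightarrow> 'x mon \<Rightarrow> bool"
    and F :: "('x, 'a::field) mpoly list"
    and i :: nat
    and s :: "('x, 'a) state"
    and Gcurr :: "nat set"
  assumes "monomial_order less_mon"
    and "\<forall>f\<in>set F. f \<noteq> 0 \<and> homogeneous f"
    and "monomial_order.sorted_input less_mon F"
    and "2 \<le> i" and "i \<le> length F"
    and "monomial_order.f5c_pass_result less_mon F i s Gcurr"
  shows "monomial_order.groebner_basis less_mon (Poly s ` Gcurr) (ideal_gen (set (take i F)))"
proof -
  interpret monomial_order less_mon by (rule assms(1))
  obtain s' Gprev B s1 where loop: "f5c_loop F i s' Gprev B"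
    and s1: "s1 = append_input (F ! (i - 1)) s'"
    and run: "incremental_basis s1 (num s1) B Gprev s Gcurr"
    using assms(6) unfolding f5c_pass_result_def by blast
  have "F \<noteq> []" "\<forall>f\<in>set F. f \<noteq> 0" "F ! (i - 1) \<noteq> 0"
    using assms(2,4,5) by auto
  then show ?thesis
    using pass_correct[OF _ _ s1 run] f5c_loop_invariant[OF loop] set_take_pred[OF assms(4,5)]
    by simp
qed

end
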